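(* Let $\beta>0$, $J,h\in\mathbb R$, and let $\mu^M_\infty$ be the multiplicative Ising measure on $\Omega=\{-1,1\}^{\mathbb N}$ with parameters $\beta,J,h$. For every first-layer function $f$, $f(\sigma)=f^*(\tau^1)$, the pressure $$\mathcal P^M(f|\mu^M_\infty)=\lim_{N\to\infty}\frac1N\log\mathbb E_{\mu_\infty^M}\Big(e^{\sum_{i=1}^NT_if}\Big)$$ exists and is given by $$\mathcal P^M(f|\mu^M_\infty)=\sum_{k=0}^\infty\frac1{2^{k+2}}\,P^k_{\mu^{\mathrm{Ising}}_\infty}(f^* ),\qquad P^k_{\mu^{\mathrm{Ising}}_\infty}(f^* )=\log\mathbb E_{\mu^{\mathrm{Ising}}_\infty}\Big(e^{\sum_{i=0}^k\theta_if^*}\Big).$$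
   Context: $\mathbb N=\{1,2,\ldots\}$, $\mathbb N_0=\mathbb N\cup\{0\}$, $\Omega_0=\{-1,1\}^{\mathbb N_0}$. Multiplicative shift: $(T_i\sigma)_j=\sigma_{ij}$ on $\Omega$, $T_if(\sigma)=f(T_i\sigma)$. Shift: $(\theta_i\tau)_j=\tau_{i+j}$ on $\Omega_0$, $\theta_if^*(\tau)=f^*(\theta_i\tau)$. For odd $r\in\mathbb N$ put $\tau^r_i=\sigma_{r2^i}$, $i\in\mathbb N_0$. A continuous function $f:\Omega\to\mathbb R$ is a first-layer function if there is a continuous $f^*:\Omega_0\to\mathbb R$ with $f(\sigma)=f^*(\tau^1)$. The multiplicative Ising measure $\mu^M_\infty$ is the unique Gibbs measure on $\Omega$ (weights $e^{-\text{energy}}$) for the potential $U(\{i\},\sigma)=-\beta h\sigma_i$, $U(\{i,2i\},\sigma)=-\beta J\sigma_i\sigma_{2i}$, $U(A,\sigma)=0$ otherwise; equivalently, it is the law of $\sigma$ under which the layers $\tau^r$ ($r$ odd) are independent and each distributed as $\mu^{\mathrm{Ising}}_\infty$, the weak limit as $N\to\infty$ of the probability measures on $\{-1,1\}^{\{0,\ldots,N\}}$ with weights proportional to $\exp\big(\beta(\sum_{i=0}^{N-1}J\tau_i\tau_{i+1}+\sum_{i=0}^Nh\tau_i\pm\tau_N)\big)$ (the limit does not depend on the sign). *)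

theory Defs
  imports "HOL-Probability.Probability"
begin

text \<open>
  Spins are the reals \<open>-1\<close> and \<open>1\<close>. Configurations over an index set \<open>I\<close> of natural numbers are
  the extensional functions in \<open>configs I\<close>, so \<open>\<Omega>\<close> is \<open>configs {1..}\<close> and \<open>\<Omega>\<^sub>0\<close> is
  \<open>configs UNIV\<close>. The product topology of the type \<^typ>\<open>nat \<Rightarrow> real\<close> induces on \<open>configs I\<close> the
  product of the discrete topologies, whose Borel sets are those of \<open>config_space I\<close>.
\<close>

definition configs :: "nat set \<Rightarrow> (nat \<Rightarrow> real) set" where
  "configs I = PiE I (\<lambda>_. {-1, 1})"

definition config_space :: "nat set \<Rightarrow> (nat \<Rightarrow> real) measure" where
  "config_space I = PiM I (\<lambda>_. count_space {-1, 1})"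

abbreviation Omega :: "(nat \<Rightarrow> real) set" where
  "Omega \<equiv> configs {1..}"

abbreviation Omega0 :: "(nat \<Rightarrow> real) set" where
  "Omega0 \<equiv> configs UNIV"

definition mult_shift :: "nat \<Rightarrow> (nat \<Rightarrow> real) \<Rightarrow> nat \<Rightarrow> real" where
  "mult_shift i \<sigma> = (\<lambda>j\<in>{1..}. \<sigma> (i * j))"

definition add_shift :: "nat \<Rightarrow> (nat \<Rightarrow> real) \<Rightarrow> nat \<Rightarrow> real" where
  "add_shift i \<tau> = (\<lambda>j. \<tau> (i + j))"

definition layer :: "nat \<Rightarrow> (nat \<Rightarrow> real) \<Rightarrow> nat \<Rightarrow> real" where
  "layer r \<sigma> = (\<lambda>i. \<sigma> (r * 2 ^ i))"

definition first_layer_function ::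
    "((nat \<Rightarrow> real) \<Rightarrow> real) \<Rightarrow> ((nat \<Rightarrow> real) \<Rightarrow> real) \<Rightarrow> bool" where
  "first_layer_function f fstar \<longleftrightarrow>
     continuous_on Omega f \<and> continuous_on Omega0 fstar \<and>
     (\<forall>\<sigma>\<in>Omega. f \<sigma> = fstar (layer 1 \<sigma>))"

definition mult_ising_potential ::
    "real \<Rightarrow> real \<Rightarrow> real \<Rightarrow> nat set \<Rightarrow> (nat \<Rightarrow> real) \<Rightarrow> real" where
  "mult_ising_potential \<beta> J h A \<sigma> =
     (let i = Min A in
      if A = {i} then - \<beta> * h * \<sigma> i
      else if A = {i, 2 * i} then - \<beta> * J * \<sigma> i * \<sigma> (2 * i)
      else 0)"

text \<open>
  For finite \<open>\<Lambda>\<close> only finitely many terms of the following sum are nonzero; \<open>infsum\<close> is used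
  because \<open>sum\<close> vanishes on infinite index sets.
\<close>

definition local_energy ::
    "(nat set \<Rightarrow> (nat \<Rightarrow> real) \<Rightarrow> real) \<Rightarrow> nat set \<Rightarrow> (nat \<Rightarrow> real) \<Rightarrow> real" where
  "local_energy U \<Lambda> \<sigma> = infsum (\<lambda>A. U A \<sigma>) {A. finite A \<and> A \<subseteq> {1..} \<and> A \<inter> \<Lambda> \<noteq> {}}"

definition glue :: "nat set \<Rightarrow> (nat \<Rightarrow> real) \<Rightarrow> (nat \<Rightarrow> real) \<Rightarrow> nat \<Rightarrow> real" where
  "glue \<Lambda> \<xi> \<omega> = (\<lambda>i. if i \<in> \<Lambda> then \<xi> i else \<omega> i)"

definition gibbs_kernel ::
    "(nat set \<Rightarrow> (nat \<Rightarrow> real) \<Rightarrow> real) \<Rightarrow> nat set \<Rightarrow> (nat \<Rightarrow> real) set \<Rightarrow> (nat \<Rightarrow> real) \<Rightarrow> real" where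
  "gibbs_kernel U \<Lambda> B \<omega> =
     (\<Sum>\<xi>\<in>configs \<Lambda>. indicator B (glue \<Lambda> \<xi> \<omega>) * exp (- local_energy U \<Lambda> (glue \<Lambda> \<xi> \<omega>))) /
     (\<Sum>\<xi>\<in>configs \<Lambda>. exp (- local_energy U \<Lambda> (glue \<Lambda> \<xi> \<omega>)))"

text \<open>
  Gibbs measures on \<open>\<Omega>\<close> in the sense of the Dobrushin-Lanford-Ruelle equations. The inverse
  temperature is part of the potential.
\<close>

definition is_gibbs_measure ::
    "(nat set \<Rightarrow> (nat \<Rightarrow> real) \<Rightarrow> real) \<Rightarrow> (nat \<Rightarrow> real) measure \<Rightarrow> bool" where
  "is_gibbs_measure U \<mu> \<longleftrightarrow>
     prob_space \<mu> \<and> sets \<mu> = sets (config_space {1..}) \<and>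
     (\<forall>\<Lambda> B. finite \<Lambda> \<and> \<Lambda> \<subseteq> {1..} \<and> B \<in> sets \<mu> \<longrightarrow>
        measure \<mu> B = (\<integral>\<omega>. gibbs_kernel U \<Lambda> B \<omega> \<partial>\<mu>))"

definition is_mult_ising_measure ::
    "real \<Rightarrow> real \<Rightarrow> real \<Rightarrow> (nat \<Rightarrow> real) measure \<Rightarrow> bool" where
  "is_mult_ising_measure \<beta> J h \<mu> \<longleftrightarrow> is_gibbs_measure (mult_ising_potential \<beta> J h) \<mu>"

definition ising_weight ::
    "real \<Rightarrow> real \<Rightarrow> real \<Rightarrow> real \<Rightarrow> nat \<Rightarrow> (nat \<Rightarrow> real) \<Rightarrow> real" where
  "ising_weight \<beta> J h s N \<tau> =
     exp (\<beta> * ((\<Sum>i<N. J * \<tau> i * \<tau> (i + 1)) + (\<Sum>i\<le>N. h * \<tau> i) + s * \<tau> N))"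

definition finite_ising ::
    "real \<Rightarrow> real \<Rightarrow> real \<Rightarrow> real \<Rightarrow> nat \<Rightarrow> (nat \<Rightarrow> real) measure" where
  "finite_ising \<beta> J h s N =
     point_measure (configs {..N})
       (\<lambda>\<tau>. ennreal (ising_weight \<beta> J h s N \<tau> / (\<Sum>\<tau>'\<in>configs {..N}. ising_weight \<beta> J h s N \<tau>')))"

text \<open>
  To test a measure on \<open>{-1,1}\<^bsup>{0..N}\<^esup>\<close> against continuous functions on \<open>\<Omega>\<^sub>0\<close>, configurations are
  extended by the spin \<open>1\<close>; the weak limit does not depend on the choice of the extension.
  The sign \<open>s\<close> is that of the boundary term; the limit is the same for both signs.
\<close>

definition is_ising_measure ::
    "real \<Rightarrow> real \<Rightarrow> real \<Rightarrow> (nat \<Rightarrow> real) measure \<Rightarrow> bool" where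
  "is_ising_measure \<beta> J h \<mu> \<longleftrightarrow>
     prob_space \<mu> \<and> sets \<mu> = sets (config_space UNIV) \<and>
     (\<forall>s\<in>{-1, 1}. \<forall>g :: (nat \<Rightarrow> real) \<Rightarrow> real. continuous_on Omega0 g \<longrightarrow>
        (\<lambda>N. \<integral>\<tau>. g (glue {..N} \<tau> (\<lambda>_. 1)) \<partial>finite_ising \<beta> J h s N) \<longlonglongrightarrow> (\<integral>\<tau>. g \<tau> \<partial>\<mu>))"

definition finite_pressure ::
    "(nat \<Rightarrow> real) measure \<Rightarrow> ((nat \<Rightarrow> real) \<Rightarrow> real) \<Rightarrow> nat \<Rightarrow> real" where
  "finite_pressure \<mu> f N = 1 / real N * ln (\<integral>\<sigma>. exp (\<Sum>i=1..N. f (mult_shift i \<sigma>)) \<partial>\<mu>)"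

definition layer_pressure ::
    "(nat \<Rightarrow> real) measure \<Rightarrow> ((nat \<Rightarrow> real) \<Rightarrow> real) \<Rightarrow> nat \<Rightarrow> real" where
  "layer_pressure \<mu> fstar k = ln (\<integral>\<tau>. exp (\<Sum>i=0..k. fstar (add_shift i \<tau>)) \<partial>\<mu>)"

end

theory Submission
  imports Defs
begin

text \<open>
  For odd \<open>r\<close> the Gibbs weights couple the spins of the layer \<open>{r 2^k}\<close> only to each other, so the
  DLR equation for the first \<open>n + 1\<close> sites of a layer is that of the one-dimensional Ising chain
  with boundary field \<open>J \<sigma>(r 2^(n+1))\<close>. The chain forgets its boundary field geometrically fast;
  letting \<open>n\<close> tend to infinity splits off one layer at a time with the Ising law. Every \<open>i \<le> N\<close> is
  \<open>r 2^k\<close> for a unique odd \<open>r\<close>, and \<open>T\<^sub>i f\<close> is \<open>\<theta>\<^sub>k fstar\<close> evaluated at the layer of \<open>r\<close>. Thus the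
  expectation is a product over odd \<open>r \<le> N\<close>; the factor of \<open>r\<close> is \<open>exp (P\<^sup>k)\<close> for the largest \<open>k\<close> with
  \<open>r 2^k \<le> N\<close>, and the number of such \<open>r\<close> divided by \<open>N\<close> tends to \<open>1/2^(k+2)\<close>. Tannery's theorem concludes.
\<close>

subsection \<open>Spin configurations\<close>

lemma finite_configs: "finite I \<Longrightarrow> finite (configs I)"
  unfolding configs_def by (intro finite_PiE) auto

lemma configs_not_empty: "configs I \<noteq> {}"
  unfolding configs_def by (auto simp: PiE_eq_empty_iff)

lemma configs_spin: "\<xi> \<in> configs I \<Longrightarrow> i \<in> I \<Longrightarrow> \<xi> i = -1 \<or> \<xi> i = 1"
  unfolding configs_def by (auto dest!: PiE_mem)

lemma space_config_space: "space (config_space I) = configs I"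
  by (simp add: config_space_def configs_def space_PiM)

text \<open>Cutting after site \<open>m\<close> and filling up with the spin \<open>1\<close> makes
  a function local; the filling agrees with the one in \<open>is_ising_measure\<close>. A general
  \<open>I\<close> covers infinite configurations as well as those on \<open>{..n}\<close>.\<close>

lemma cut_Omega0:
  assumes "\<tau> \<in> configs I" "{..m} \<subseteq> I"
  shows "glue {..m} \<tau> (\<lambda>_. 1) \<in> Omega0"
proof -
  have "\<tau> i = -1 \<or> \<tau> i = 1" if "i \<le> m" for i
    using that assms by (intro configs_spin[of \<tau> I]) auto
  then show ?thesis by (auto simp: configs_def[of UNIV] glue_def; metis)
qed

text \<open>Tychonoff's theorem, as the spin set is finite.\<close>

lemma compact_Omega0: "compact Omega0"
proof -
  have "compactin (product_topology (\<lambda>_. euclidean) UNIV) (PiE UNIV (\<lambda>_::nat. {-1, 1::real}))"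
    by (subst compactin_PiE) auto
  then show ?thesis
    unfolding configs_def by (simp add: euclidean_product_topology)
qed

lemma bounded_on_Omega0:
  assumes "continuous_on Omega0 F"
  obtains B :: real where "0 \<le> B" "\<And>\<tau>. \<tau> \<in> Omega0 \<Longrightarrow> \<bar>F \<tau>\<bar> \<le> B"
proof -
  have "compact (F ` Omega0)"
    using assms compact_Omega0 by (rule compact_continuous_image)
  then obtain B where "0 < B" "\<forall>x\<in>F ` Omega0. norm x \<le> B"
    using bounded_pos compact_imp_bounded by blast
  then show thesis
    by (intro that[of B]) auto
qed

lemma continuous_on_cut:
  assumes "continuous_on Omega0 (F :: _ \<Rightarrow> real)"
  shows "continuous_on Omega0 (\<lambda>\<tau>. F (glue {..m} \<tau> (\<lambda>_. 1)))"
proof (rule continuous_on_compose2[OF assms])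
  show "continuous_on Omega0 (\<lambda>\<tau>. glue {..m} \<tau> (\<lambda>_. 1::real))"
  proof (rule continuous_on_coordinatewise_then_product)
    fix i
    show "continuous_on Omega0 (\<lambda>\<tau>. glue {..m} \<tau> (\<lambda>_. 1::real) i)"
      by (cases "i \<le> m")
        (auto simp: glue_def intro: continuous_on_subset[OF continuous_on_product_coordinates])
  qed
qed (auto simp: cut_Omega0[of _ UNIV])

text \<open>Every coordinate of the cuts is eventually constant in \<open>m\<close>, so the cuts
  converge to \<tau> in the product topology.\<close>

lemma cut_tendsto:
  assumes "continuous_on Omega0 (F :: _ \<Rightarrow> real)" "\<tau> \<in> Omega0"
  shows "(\<lambda>m. F (glue {..m} \<tau> (\<lambda>_. 1))) \<longlonglongrightarrow> F \<tau>"
proof (rule continuous_on_tendsto_compose[OF assms(1) _ assms(2)])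
  have "limitin (product_topology (\<lambda>_. euclidean) UNIV) (\<lambda>m. glue {..m} \<tau> (\<lambda>_. 1)) \<tau> sequentially"
    unfolding limitin_componentwise
  proof (intro conjI ballI)
    fix i :: nat
    have "eventually (\<lambda>m. glue {..m} \<tau> (\<lambda>_. 1) i = \<tau> i) sequentially"
      using eventually_ge_at_top[of i] by eventually_elim (auto simp: glue_def)
    then show "limitin euclidean (\<lambda>c. glue {..c} \<tau> (\<lambda>_. 1) i) (\<tau> i) sequentially"
      by (simp add: tendsto_eventually)
  qed auto
  then show "(\<lambda>m. glue {..m} \<tau> (\<lambda>_. 1)) \<longlonglongrightarrow> \<tau>"
    by (simp add: euclidean_product_topology)
qed (simp add: cut_Omega0[of _ UNIV] assms)

text \<open>The cut factors through the restriction to \<open>{..m}\<close>, whose configuration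
  space is finite and discrete, so any \<open>F\<close> is allowed.\<close>

lemma measurable_cut:
  "(\<lambda>\<tau>. F (glue {..m} \<tau> (\<lambda>_. 1))) \<in> borel_measurable (config_space UNIV)"
proof -
  have r: "(\<lambda>\<tau>. restrict \<tau> {..m}) \<in> measurable (config_space UNIV) (count_space (configs {..m}))"
  proof -
    have "(\<lambda>\<tau>. restrict \<tau> {..m}) \<in> measurable (config_space UNIV) (config_space {..m})"
      unfolding config_space_def by (intro measurable_restrict_subset) auto
    also have "config_space {..m} = count_space (configs {..m})"
      unfolding config_space_def configs_def by (intro count_space_PiM_finite) auto
    finally show ?thesis .
  qed
  have "glue {..m} \<tau> (\<lambda>_. 1) = glue {..m} (restrict \<tau> {..m}) (\<lambda>_. 1)" for \<tau> :: "nat \<Rightarrow> real"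
    by (auto simp: glue_def)
  moreover have "(\<lambda>\<tau>. F (glue {..m} (restrict \<tau> {..m}) (\<lambda>_. 1))) \<in> borel_measurable (config_space UNIV)"
    by (rule measurable_compose[OF r]) simp
  ultimately show ?thesis by simp
qed

text \<open>A continuous function is the pointwise limit of its cuts; this links the topology to the
  product sigma-algebra.\<close>

lemma continuous_imp_measurable:
  assumes "continuous_on Omega0 (F :: _ \<Rightarrow> real)"
  shows "F \<in> borel_measurable (config_space UNIV)"
proof (rule borel_measurable_LIMSEQ_real)
  show "(\<lambda>m. F (glue {..m} \<tau> (\<lambda>_. 1))) \<longlonglongrightarrow> F \<tau>" if "\<tau> \<in> space (config_space UNIV)" for \<tau>
    using that cut_tendsto[OF assms] by (simp add: space_config_space)
qed (rule measurable_cut)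

text \<open>The DLR equation speaks of events; the usual induction over measurable functions extends
  it to nonnegative \<open>u\<close>. In the application \<open>T \<xi>\<close> puts the spins
  \<open>\<xi>\<close> into the volume and \<open>c \<xi>\<close> is their conditional
  probability.\<close>

lemma dlr_integral:
  fixes c :: "'x \<Rightarrow> 'a \<Rightarrow> real" and u :: "'a \<Rightarrow> real"
  assumes "prob_space \<mu>" "finite X"
    and T: "\<And>\<xi>. \<xi> \<in> X \<Longrightarrow> T \<xi> \<in> measurable \<mu> \<mu>"
    and c: "\<And>\<xi>. \<xi> \<in> X \<Longrightarrow> c \<xi> \<in> borel_measurable \<mu>"
    and c0: "\<And>\<xi> \<omega>. \<xi> \<in> X \<Longrightarrow> 0 \<le> c \<xi> \<omega>"
    and c1: "\<And>\<xi> \<omega>. \<xi> \<in> X \<Longrightarrow> c \<xi> \<omega> \<le> 1"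
    and dlr: "\<And>B. B \<in> sets \<mu> \<Longrightarrow> measure \<mu> B = (\<integral>\<omega>. (\<Sum>\<xi>\<in>X. indicator B (T \<xi> \<omega>) * c \<xi> \<omega>) \<partial>\<mu>)"
    and u: "u \<in> borel_measurable \<mu>" "\<And>x. x \<in> space \<mu> \<Longrightarrow> 0 \<le> u x"
  shows "(\<integral>\<omega>. u \<omega> \<partial>\<mu>) = (\<integral>\<omega>. (\<Sum>\<xi>\<in>X. u (T \<xi> \<omega>) * c \<xi> \<omega>) \<partial>\<mu>)"
proof -
  interpret prob_space \<mu> by fact
  note [measurable] = T c
  \<comment> \<open>The induction runs over \<open>ennreal\<close>-valued functions, so that no
    integrability has to be carried along.\<close>
  have nn: "(\<integral>\<^sup>+\<omega>. v \<omega> \<partial>\<mu>) = (\<Sum>\<xi>\<in>X. \<integral>\<^sup>+\<omega>. v (T \<xi> \<omega>) * ennreal (c \<xi> \<omega>) \<partial>\<mu>)"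
    if "v \<in> borel_measurable \<mu>" for v
    using that
  proof (induction rule: borel_measurable_induct)
    case (cong f g)
    have "(\<integral>\<^sup>+\<omega>. f \<omega> \<partial>\<mu>) = (\<integral>\<^sup>+\<omega>. g \<omega> \<partial>\<mu>)"
      by (intro nn_integral_cong) (simp add: cong)
    moreover have "(\<integral>\<^sup>+\<omega>. f (T \<xi> \<omega>) * ennreal (c \<xi> \<omega>) \<partial>\<mu>) = (\<integral>\<^sup>+\<omega>. g (T \<xi> \<omega>) * ennreal (c \<xi> \<omega>) \<partial>\<mu>)"
      if "\<xi> \<in> X" for \<xi>
      using measurable_space[OF T[OF that]] by (intro nn_integral_cong) (simp add: cong)
    ultimately show ?case using cong by simp
  next
    \<comment> \<open>Here \<open>dlr\<close> enters. The bounds on \<open>c\<close> make the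
      integrands integrable, so the Bochner integrals agree with the nonnegative ones.\<close>
    case (set B)
    have int: "integrable \<mu> (\<lambda>\<omega>. indicator B (T \<xi> \<omega>) * c \<xi> \<omega>)" if "\<xi> \<in> X" for \<xi>
    proof (rule integrable_const_bound[of _ 1])
      show "AE \<omega> in \<mu>. norm (indicator B (T \<xi> \<omega>) * c \<xi> \<omega>) \<le> 1"
        using c0[OF that] c1[OF that] by (auto simp: indicator_def)
      show "(\<lambda>\<omega>. indicator B (T \<xi> \<omega>) * c \<xi> \<omega>) \<in> borel_measurable \<mu>"
        using that set by measurable
    qed
    have "(\<integral>\<^sup>+\<omega>. indicator B \<omega> \<partial>\<mu>) = ennreal (measure \<mu> B)"
      using set by (simp add: emeasure_eq_measure)
    also have "\<dots> = ennreal (\<Sum>\<xi>\<in>X. \<integral>\<omega>. indicator B (T \<xi> \<omega>) * c \<xi> \<omega> \<partial>\<mu>)"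
      using int by (simp add: dlr[OF set] Bochner_Integration.integral_sum)
    also have "\<dots> = (\<Sum>\<xi>\<in>X. ennreal (\<integral>\<omega>. indicator B (T \<xi> \<omega>) * c \<xi> \<omega> \<partial>\<mu>))"
      by (intro sum_ennreal[symmetric] Bochner_Integration.integral_nonneg) (simp add: c0)
    also have "\<dots> = (\<Sum>\<xi>\<in>X. \<integral>\<^sup>+\<omega>. ennreal (indicator B (T \<xi> \<omega>) * c \<xi> \<omega>) \<partial>\<mu>)"
      using int by (intro sum.cong refl nn_integral_eq_integral[symmetric]) (auto simp: c0)
    also have "\<dots> = (\<Sum>\<xi>\<in>X. \<integral>\<^sup>+\<omega>. indicator B (T \<xi> \<omega>) * ennreal (c \<xi> \<omega>) \<partial>\<mu>)"
      by (intro sum.cong refl nn_integral_cong) (auto simp: indicator_def)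
    finally show ?case .
  next
    case (mult f a)
    note [measurable] = \<open>f \<in> borel_measurable \<mu>\<close>
    have "(\<Sum>\<xi>\<in>X. \<integral>\<^sup>+\<omega>. a * f (T \<xi> \<omega>) * ennreal (c \<xi> \<omega>) \<partial>\<mu>) =
        (\<Sum>\<xi>\<in>X. a * (\<integral>\<^sup>+\<omega>. f (T \<xi> \<omega>) * ennreal (c \<xi> \<omega>) \<partial>\<mu>))"
      by (intro sum.cong refl) (simp add: nn_integral_cmult mult.assoc)
    then show ?case using mult by (simp add: nn_integral_cmult sum_distrib_left)
  next
    case (add f g)
    note [measurable] = \<open>f \<in> borel_measurable \<mu>\<close> \<open>g \<in> borel_measurable \<mu>\<close>
    have "(\<Sum>\<xi>\<in>X. \<integral>\<^sup>+\<omega>. (g (T \<xi> \<omega>) + f (T \<xi> \<omega>)) * ennreal (c \<xi> \<omega>) \<partial>\<mu>) =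
        (\<Sum>\<xi>\<in>X. (\<integral>\<^sup>+\<omega>. g (T \<xi> \<omega>) * ennreal (c \<xi> \<omega>) \<partial>\<mu>) + (\<integral>\<^sup>+\<omega>. f (T \<xi> \<omega>) * ennreal (c \<xi> \<omega>) \<partial>\<mu>))"
    proof (intro sum.cong refl)
      fix \<xi> assume \<xi>: "\<xi> \<in> X"
      note [measurable] = T[OF \<xi>] c[OF \<xi>]
      have "(\<lambda>\<omega>. g (T \<xi> \<omega>) * ennreal (c \<xi> \<omega>)) \<in> borel_measurable \<mu>"
           "(\<lambda>\<omega>. f (T \<xi> \<omega>) * ennreal (c \<xi> \<omega>)) \<in> borel_measurable \<mu>"
        by measurable
      then show "(\<integral>\<^sup>+\<omega>. (g (T \<xi> \<omega>) + f (T \<xi> \<omega>)) * ennreal (c \<xi> \<omega>) \<partial>\<mu>) =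
          (\<integral>\<^sup>+\<omega>. g (T \<xi> \<omega>) * ennreal (c \<xi> \<omega>) \<partial>\<mu>) + (\<integral>\<^sup>+\<omega>. f (T \<xi> \<omega>) * ennreal (c \<xi> \<omega>) \<partial>\<mu>)"
        by (simp add: distrib_right nn_integral_add)
    qed
    then show ?case using add by (simp add: nn_integral_add sum.distrib)
  next
    case (seq U)
    note [measurable] = seq(1)
    have mono: "incseq (\<lambda>i \<omega>. U i (T \<xi> \<omega>) * ennreal (c \<xi> \<omega>))" for \<xi>
      using seq by (auto simp: incseq_def le_fun_def intro!: mult_right_mono)
    have mono': "incseq (\<lambda>i. \<integral>\<^sup>+\<omega>. U i (T \<xi> \<omega>) * ennreal (c \<xi> \<omega>) \<partial>\<mu>)" for \<xi>
      using mono[of \<xi>] by (auto simp: incseq_def le_fun_def intro!: nn_integral_mono)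
    have "(\<integral>\<^sup>+\<omega>. (SUP i. U i) \<omega> \<partial>\<mu>) = (SUP i. \<integral>\<^sup>+\<omega>. U i \<omega> \<partial>\<mu>)"
      using seq by (simp add: nn_integral_monotone_convergence_SUP image_comp)
    also have "\<dots> = (SUP i. \<Sum>\<xi>\<in>X. \<integral>\<^sup>+\<omega>. U i (T \<xi> \<omega>) * ennreal (c \<xi> \<omega>) \<partial>\<mu>)"
      using seq by simp
    also have "\<dots> = (\<Sum>\<xi>\<in>X. SUP i. \<integral>\<^sup>+\<omega>. U i (T \<xi> \<omega>) * ennreal (c \<xi> \<omega>) \<partial>\<mu>)"
      using mono' by (simp add: ennreal_SUP_sum)
    also have "\<dots> = (\<Sum>\<xi>\<in>X. \<integral>\<^sup>+\<omega>. (SUP i. U i) (T \<xi> \<omega>) * ennreal (c \<xi> \<omega>) \<partial>\<mu>)"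
    proof (intro sum.cong refl)
      fix \<xi> assume "\<xi> \<in> X"
      then have "(SUP i. \<integral>\<^sup>+\<omega>. U i (T \<xi> \<omega>) * ennreal (c \<xi> \<omega>) \<partial>\<mu>) =
          (\<integral>\<^sup>+\<omega>. (SUP i. U i (T \<xi> \<omega>) * ennreal (c \<xi> \<omega>)) \<partial>\<mu>)"
        by (intro nn_integral_monotone_convergence_SUP[symmetric] mono) measurable
      then show "(SUP i. \<integral>\<^sup>+\<omega>. U i (T \<xi> \<omega>) * ennreal (c \<xi> \<omega>) \<partial>\<mu>) =
          (\<integral>\<^sup>+\<omega>. (SUP i. U i) (T \<xi> \<omega>) * ennreal (c \<xi> \<omega>) \<partial>\<mu>)"
        by (simp add: SUP_mult_right_ennreal image_comp)
    qed
    finally show ?case .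
  qed
  \<comment> \<open>This also holds if the right integral is infinite: both sides are then
    \<open>0\<close>. Hence \<open>u\<close> may be unbounded.\<close>
  have "(\<integral>\<omega>. u \<omega> \<partial>\<mu>) = enn2real (\<integral>\<^sup>+\<omega>. ennreal (u \<omega>) \<partial>\<mu>)"
    using u by (intro integral_eq_nn_integral) auto
  also have "(\<integral>\<^sup>+\<omega>. ennreal (u \<omega>) \<partial>\<mu>) = (\<Sum>\<xi>\<in>X. \<integral>\<^sup>+\<omega>. ennreal (u (T \<xi> \<omega>)) * ennreal (c \<xi> \<omega>) \<partial>\<mu>)"
    using u by (intro nn) measurable
  also have "\<dots> = (\<integral>\<^sup>+\<omega>. (\<Sum>\<xi>\<in>X. ennreal (u (T \<xi> \<omega>)) * ennreal (c \<xi> \<omega>)) \<partial>\<mu>)"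
  proof (rule nn_integral_sum[symmetric])
    fix \<xi> assume \<xi>: "\<xi> \<in> X"
    note [measurable] = T[OF \<xi>] c[OF \<xi>] u(1)
    show "(\<lambda>\<omega>. ennreal (u (T \<xi> \<omega>)) * ennreal (c \<xi> \<omega>)) \<in> borel_measurable \<mu>" by measurable
  qed
  also have "\<dots> = (\<integral>\<^sup>+\<omega>. ennreal (\<Sum>\<xi>\<in>X. u (T \<xi> \<omega>) * c \<xi> \<omega>) \<partial>\<mu>)"
    using measurable_space[OF T]
    by (intro nn_integral_cong) (auto simp: u c0 ennreal_mult[symmetric] sum_ennreal)
  also have "enn2real \<dots> = (\<integral>\<omega>. (\<Sum>\<xi>\<in>X. u (T \<xi> \<omega>) * c \<xi> \<omega>) \<partial>\<mu>)"
  proof (rule integral_eq_nn_integral[symmetric])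
    show "(\<lambda>\<omega>. \<Sum>\<xi>\<in>X. u (T \<xi> \<omega>) * c \<xi> \<omega>) \<in> borel_measurable \<mu>"
      using u by measurable
    show "AE \<omega> in \<mu>. 0 \<le> (\<Sum>\<xi>\<in>X. u (T \<xi> \<omega>) * c \<xi> \<omega>)"
      using measurable_space[OF T] by (intro AE_I2 sum_nonneg) (auto simp: u c0)
  qed
  finally show ?thesis .
qed

subsection \<open>Loss of memory in the Ising chain\<close>

text \<open>The boundary field \<open>s\<close> is an arbitrary real: the DLR equation for a layer
  produces the field \<open>J\<close> times the next spin, not just a sign.\<close>

definition ising_mean ::
    "real \<Rightarrow> real \<Rightarrow> real \<Rightarrow> real \<Rightarrow> nat \<Rightarrow> ((nat \<Rightarrow> real) \<Rightarrow> real) \<Rightarrow> real" where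
  "ising_mean \<beta> J h s n g =
     (\<Sum>\<eta>\<in>configs {..n}. g \<eta> * ising_weight \<beta> J h s n \<eta>) / (\<Sum>\<eta>\<in>configs {..n}. ising_weight \<beta> J h s n \<eta>)"

lemma sum_configs_pos:
  assumes "finite I" "\<And>\<eta>. (0::real) < w \<eta>"
  shows "0 < (\<Sum>\<eta>\<in>configs I. w \<eta>)"
  using assms by (intro sum_pos finite_configs configs_not_empty)

lemma ising_weight_pos: "0 < ising_weight \<beta> J h s n \<eta>"
  by (simp add: ising_weight_def)

lemma sum_ising_weight_pos: "0 < (\<Sum>\<eta>\<in>configs {..n}. ising_weight \<beta> J h s n \<eta>)"
  by (intro sum_configs_pos ising_weight_pos) simp

lemma integral_finite_ising: "(\<integral>\<tau>. g \<tau> \<partial>finite_ising \<beta> J h s n) = ising_mean \<beta> J h s n g"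
  using less_imp_le[OF sum_ising_weight_pos] less_imp_le[OF ising_weight_pos]
  by (simp add: finite_ising_def ising_mean_def lebesgue_integral_point_measure_finite finite_configs
      sum_divide_distrib mult.commute)

lemma sum_configs_Suc:
  "(\<Sum>\<eta>\<in>configs {..Suc n}. G \<eta>) =
     (\<Sum>\<eta>\<in>configs {..n}. G (\<eta>(Suc n := 1))) + (\<Sum>\<eta>\<in>configs {..n}. (G (\<eta>(Suc n := -1)) :: real))"
proof -
  have "(\<Sum>\<eta>\<in>configs {..Suc n}. G \<eta>) =
      (\<Sum>(\<epsilon>, \<eta>)\<in>{-1, 1} \<times> configs {..n}. G (\<eta>(Suc n := \<epsilon>)))"
    unfolding configs_def atMost_Suc PiE_insert_eq
    by (subst sum.reindex) (auto intro!: inj_combinator sum.cong)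
  also have "\<dots> = (\<Sum>\<epsilon>\<in>{-1, 1}. \<Sum>\<eta>\<in>configs {..n}. G (\<eta>(Suc n := \<epsilon>)))"
    by (simp add: sum.cartesian_product)
  finally show ?thesis by simp
qed

text \<open>The bond between the last two sites acts on the chain \<open>{..n}\<close> as the
  boundary field \<open>J * \<epsilon>\<close>.\<close>

lemma ising_weight_Suc:
  "ising_weight \<beta> J h s (Suc n) (\<eta>(Suc n := \<epsilon>)) = ising_weight \<beta> J h (J * \<epsilon>) n \<eta> * exp (\<beta> * (h + s) * \<epsilon>)"
proof -
  have "(\<Sum>i<n. J * (\<eta>(Suc n := \<epsilon>)) i * (\<eta>(Suc n := \<epsilon>)) (i + 1)) = (\<Sum>i<n. J * \<eta> i * \<eta> (i + 1))"
       "(\<Sum>i\<le>n. h * (\<eta>(Suc n := \<epsilon>)) i) = (\<Sum>i\<le>n. h * \<eta> i)"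
    by (intro sum.cong; simp)+
  then show ?thesis
    by (simp add: ising_weight_def exp_add[symmetric] algebra_simps del: fun_upd_apply)
       (simp add: algebra_simps)
qed

text \<open>A change of boundary field shifts the exponent by
  \<open>\<beta> * (s - s') * \<eta> n\<close>; the resulting factor does not depend on
  \<open>n\<close>.\<close>

lemma ising_weight_boundary:
  assumes "\<eta> \<in> configs {..n}"
  shows "ising_weight \<beta> J h s n \<eta> \<le> exp \<bar>\<beta> * (s - s')\<bar> * ising_weight \<beta> J h s' n \<eta>"
proof -
  have "\<beta> * (s - s') * \<eta> n \<le> \<bar>\<beta> * (s - s')\<bar>"
    using configs_spin[OF assms, of n] by auto
  then show ?thesis
    by (simp add: ising_weight_def exp_add[symmetric] algebra_simps)
qed

lemma convex_weight_bounds: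
  fixes a b :: real
  assumes "0 < a" "0 < b" "a \<le> E * b" "b \<le> E * a"
  shows "1 / (1 + E) \<le> a / (a + b)" "a / (a + b) \<le> 1 - 1 / (1 + E)"
proof -
  have E: "0 < E" using assms by (smt (verit) mult_nonpos_nonneg)
  show "1 / (1 + E) \<le> a / (a + b)"
    using assms E by (simp add: field_simps)
  have "1 / (1 + E) \<le> b / (a + b)"
    using assms E by (simp add: field_simps)
  moreover have "a / (a + b) = 1 - b / (a + b)"
    using assms by (simp add: field_simps)
  ultimately show "a / (a + b) \<le> 1 - 1 / (1 + E)" by simp
qed

text \<open>
  Conditioning on the last spin: the mean over \<open>{0..n+1}\<close> is a convex combination of the means over
  \<open>{0..n}\<close> with boundary fields \<open>\<plusminus>J\<close>, with weights bounded away from \<open>0\<close> and \<open>1\<close> uniformly in \<open>n\<close>.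
\<close>

definition plus_weight :: "real \<Rightarrow> real \<Rightarrow> real \<Rightarrow> real \<Rightarrow> nat \<Rightarrow> real" where
  "plus_weight \<beta> J h s n =
     (let a = (\<Sum>\<eta>\<in>configs {..n}. ising_weight \<beta> J h J n \<eta>) * exp (\<beta> * (h + s));
          b = (\<Sum>\<eta>\<in>configs {..n}. ising_weight \<beta> J h (- J) n \<eta>) * exp (- (\<beta> * (h + s)))
      in a / (a + b))"

lemma ising_mean_Suc:
  assumes "\<And>\<eta> \<epsilon>. g (\<eta>(Suc n := \<epsilon>)) = g \<eta>"
  shows "ising_mean \<beta> J h s (Suc n) g =
     plus_weight \<beta> J h s n * ising_mean \<beta> J h J n g + (1 - plus_weight \<beta> J h s n) * ising_mean \<beta> J h (- J) n g"
proof -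
  define Z where "Z t = (\<Sum>\<eta>\<in>configs {..n}. ising_weight \<beta> J h t n \<eta>)" for t
  define N where "N t = (\<Sum>\<eta>\<in>configs {..n}. g \<eta> * ising_weight \<beta> J h t n \<eta>)" for t
  define x where "x = exp (\<beta> * (h + s))"
  define y where "y = exp (- (\<beta> * (h + s)))"
  have Z: "0 < Z t" for t unfolding Z_def by (rule sum_ising_weight_pos)
  have xy: "0 < x" "0 < y" by (auto simp: x_def y_def)
  have pos: "0 < Z J * x + Z (- J) * y" using Z xy by (intro add_pos_pos mult_pos_pos)
  have q: "plus_weight \<beta> J h s n = Z J * x / (Z J * x + Z (- J) * y)"
    by (simp add: plus_weight_def Let_def Z_def x_def y_def)
  have q': "1 - plus_weight \<beta> J h s n = Z (- J) * y / (Z J * x + Z (- J) * y)"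
    unfolding q using pos by (simp add: field_simps)
  have "ising_mean \<beta> J h s (Suc n) g = (N J * x + N (- J) * y) / (Z J * x + Z (- J) * y)"
    unfolding ising_mean_def sum_configs_Suc assms ising_weight_Suc
    by (simp add: N_def Z_def x_def y_def sum_distrib_right mult.assoc)
  also have "\<dots> = plus_weight \<beta> J h s n * (N J / Z J) + (1 - plus_weight \<beta> J h s n) * (N (- J) / Z (- J))"
    unfolding q' unfolding q using Z[of J] Z[of "- J"] by (simp add: add_divide_distrib mult.commute)
  finally show ?thesis by (simp add: ising_mean_def N_def Z_def)
qed

text \<open>The partition functions with fields \<open>J\<close> and \<open>- J\<close> differ by a
  factor of at most \<open>A\<close>, uniformly in \<open>n\<close>, and the weights of the last
  spin by at most \<open>exp (2 * \<bar>x\<bar>)\<close>. So the ratio of the two terms stays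
  between \<open>1 / E\<close> and \<open>E\<close>.\<close>

lemma plus_weight_bounds:
  obtains \<delta> where "0 < \<delta>" "\<And>n. \<delta> \<le> plus_weight \<beta> J h s n" "\<And>n. plus_weight \<beta> J h s n \<le> 1 - \<delta>"
proof -
  define A where "A = exp \<bar>\<beta> * (J - (- J))\<bar>"
  define x where "x = \<beta> * (h + s)"
  define E where "E = A * exp (2 * \<bar>x\<bar>)"
  define Z where "Z n t = (\<Sum>\<eta>\<in>configs {..n}. ising_weight \<beta> J h t n \<eta>)" for n t
  have Z: "0 < Z n t" for n t unfolding Z_def by (rule sum_ising_weight_pos)
  have ZZ: "Z n J \<le> A * Z n (- J)" "Z n (- J) \<le> A * Z n J" for n
    using ising_weight_boundary[of _ n \<beta> J h J "- J"] ising_weight_boundary[of _ n \<beta> J h "- J" J]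
    by (auto simp: Z_def A_def sum_distrib_left intro!: sum_mono)
  have e: "exp x \<le> exp (2 * \<bar>x\<bar>) * exp (- x)" "exp (- x) \<le> exp (2 * \<bar>x\<bar>) * exp x"
    by (auto simp: exp_add[symmetric])
  have "Z n J * exp x \<le> E * (Z n (- J) * exp (- x))" for n
  proof -
    have "Z n J * exp x \<le> (A * Z n (- J)) * (exp (2 * \<bar>x\<bar>) * exp (- x))"
      using ZZ e Z[of n "- J"] by (intro mult_mono) (auto simp: A_def)
    then show ?thesis by (simp add: E_def mult_ac)
  qed
  moreover have "Z n (- J) * exp (- x) \<le> E * (Z n J * exp x)" for n
  proof -
    have "Z n (- J) * exp (- x) \<le> (A * Z n J) * (exp (2 * \<bar>x\<bar>) * exp x)"
      using ZZ e Z[of n J] by (intro mult_mono) (auto simp: A_def)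
    then show ?thesis by (simp add: E_def mult_ac)
  qed
  moreover have "plus_weight \<beta> J h s n = Z n J * exp x / (Z n J * exp x + Z n (- J) * exp (- x))" for n
    by (simp add: plus_weight_def Let_def Z_def x_def)
  ultimately show thesis
    using Z by (intro that[of "1 / (1 + E)"])
      (auto intro!: convex_weight_bounds add_pos_pos simp: E_def A_def)
qed

text \<open>By \<open>ising_mean_Suc\<close> the gap \<open>D\<close> between the means with fields
  \<open>J\<close> and \<open>- J\<close> is multiplied in each step by a difference of two weights,
  which is at most some \<open>c < 1\<close> in absolute value. One step later, the gap between any
  two fields is at most that of \<open>J\<close> and \<open>- J\<close>.\<close>

lemma ising_mean_forgets_boundary:
  assumes loc: "\<And>n \<eta> \<epsilon>. m \<le> n \<Longrightarrow> g (\<eta>(Suc n := \<epsilon>)) = g \<eta>"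
    and lim: "(\<lambda>n. ising_mean \<beta> J h s n g) \<longlonglongrightarrow> L"
  shows "(\<lambda>n. ising_mean \<beta> J h t n g) \<longlonglongrightarrow> L"
proof -
  let ?M = "\<lambda>t n. ising_mean \<beta> J h t n g" and ?q = "plus_weight \<beta> J h"
  define D where "D n = ?M J n - ?M (- J) n" for n
  have step: "?M t (Suc n) - ?M t' (Suc n) = (?q t n - ?q t' n) * D n" if "m \<le> n" for t t' n
    using loc[OF that] by (simp add: ising_mean_Suc D_def algebra_simps)
  have D: "D \<longlonglongrightarrow> 0"
  proof -
    obtain d1 where d1: "0 < d1" "\<And>n. d1 \<le> ?q J n" "\<And>n. ?q J n \<le> 1 - d1"
      using plus_weight_bounds[of \<beta> J h J] by metis
    obtain d2 where d2: "0 < d2" "\<And>n. d2 \<le> ?q (- J) n" "\<And>n. ?q (- J) n \<le> 1 - d2"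
      using plus_weight_bounds[of \<beta> J h "- J"] by metis
    \<comment> \<open>Numbers in \<open>[d1, 1 - d1]\<close> and \<open>[d2, 1 - d2]\<close> differ
      by at most this much.\<close>
    define c where "c = 1 - d1 - d2"
    have qc: "\<bar>?q J n - ?q (- J) n\<bar> \<le> c" for n
      using d1(2,3)[of n] d2(2,3)[of n] by (auto simp: c_def)
    have c: "0 \<le> c" "c < 1"
      using qc[of 0] d1(1) d2(1) by (auto simp: c_def intro: order_trans[OF abs_ge_zero])
    \<comment> \<open>The contraction starts at \<open>m\<close>, from where on \<open>g\<close>
      ignores the spin that is added.\<close>
    have "\<bar>D (m + k)\<bar> \<le> c ^ k * \<bar>D m\<bar>" for k
    proof (induction k)
      case (Suc k)
      have "\<bar>D (m + Suc k)\<bar> = \<bar>?q J (m + k) - ?q (- J) (m + k)\<bar> * \<bar>D (m + k)\<bar>"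
        using step[of "m + k" J "- J"] by (simp add: D_def abs_mult)
      also have "\<dots> \<le> c * (c ^ k * \<bar>D m\<bar>)"
        using qc c by (intro mult_mono Suc) auto
      finally show ?case by simp
    qed simp
    moreover have "(\<lambda>k. c ^ k * \<bar>D m\<bar>) \<longlonglongrightarrow> 0"
      using c by (intro tendsto_mult_left_zero LIMSEQ_power_zero) auto
    ultimately have "(\<lambda>k. D (m + k)) \<longlonglongrightarrow> 0"
      by (intro Lim_null_comparison[of "\<lambda>k. D (m + k)" "\<lambda>k. c ^ k * \<bar>D m\<bar>"]) auto
    then show ?thesis
      by (subst (asm) add.commute) (rule LIMSEQ_offset)
  qed
  have "(\<lambda>n. ?M t (Suc n) - ?M s (Suc n)) \<longlonglongrightarrow> 0"
  proof (rule Lim_null_comparison[OF _ tendsto_rabs_zero[OF D]])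
    obtain d1 where d1: "0 < d1" "\<And>n. d1 \<le> ?q t n" "\<And>n. ?q t n \<le> 1 - d1"
      using plus_weight_bounds[of \<beta> J h t] by metis
    obtain d2 where d2: "0 < d2" "\<And>n. d2 \<le> ?q s n" "\<And>n. ?q s n \<le> 1 - d2"
      using plus_weight_bounds[of \<beta> J h s] by metis
    have "\<bar>?q t n - ?q s n\<bar> \<le> 1" for n
      using d1(1) d1(2,3)[of n] d2(1) d2(2,3)[of n] by auto
    then have "\<bar>?M t (Suc n) - ?M s (Suc n)\<bar> \<le> \<bar>D n\<bar>" if "m \<le> n" for n
      unfolding step[OF that] abs_mult by (intro mult_left_le_one_le) auto
    then show "\<forall>\<^sub>F n in sequentially. norm (?M t (Suc n) - ?M s (Suc n)) \<le> \<bar>D n\<bar>"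
      unfolding real_norm_def using eventually_ge_at_top[of m] by (rule eventually_mono[rotated])
  qed
  from tendsto_add[OF this LIMSEQ_Suc[OF lim]] have "(\<lambda>n. ?M t (Suc n)) \<longlonglongrightarrow> L" by simp
  then show ?thesis by (rule LIMSEQ_imp_Suc)
qed

text \<open>The definition of the Ising measure gives the limit for the boundary fields
  \<open>1\<close> and \<open>-1\<close>; loss of memory carries it over from \<open>1\<close> to
  every real \<open>t\<close>.\<close>

lemma ising_mean_tendsto:
  assumes "is_ising_measure \<beta> J h \<mu>" "continuous_on Omega0 F"
  shows "(\<lambda>n. ising_mean \<beta> J h t n (\<lambda>\<eta>. F (glue {..m} \<eta> (\<lambda>_. 1)))) \<longlonglongrightarrow> (\<integral>\<tau>. F (glue {..m} \<tau> (\<lambda>_. 1)) \<partial>\<mu>)"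
proof (rule ising_mean_forgets_boundary[where m = m and s = 1])
  let ?g = "\<lambda>\<eta>. F (glue {..m} \<eta> (\<lambda>_. 1))"
  have "(\<lambda>n. ising_mean \<beta> J h 1 n (\<lambda>\<tau>. ?g (glue {..n} \<tau> (\<lambda>_. 1)))) \<longlonglongrightarrow> (\<integral>\<tau>. ?g \<tau> \<partial>\<mu>)"
    using assms(1) continuous_on_cut[OF assms(2)]
    unfolding is_ising_measure_def integral_finite_ising by blast
  \<comment> \<open>Once \<open>m \<le> n\<close>, the cut at \<open>m\<close> does not see how the
    configuration is extended beyond \<open>n\<close>.\<close>
  moreover have "\<forall>\<^sub>F n in sequentially. ising_mean \<beta> J h 1 n (\<lambda>\<tau>. ?g (glue {..n} \<tau> (\<lambda>_. 1))) = ising_mean \<beta> J h 1 n ?g"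
    using eventually_ge_at_top[of m]
  proof eventually_elim
    case (elim n)
    then have "glue {..m} (glue {..n} \<tau> (\<lambda>_. 1)) (\<lambda>_. 1) = glue {..m} \<tau> (\<lambda>_. 1)" for \<tau> :: "nat \<Rightarrow> real"
      by (auto simp: glue_def)
    then show ?case by simp
  qed
  ultimately show "(\<lambda>n. ising_mean \<beta> J h 1 n ?g) \<longlonglongrightarrow> (\<integral>\<tau>. ?g \<tau> \<partial>\<mu>)"
    by (rule Lim_transform_eventually)
qed (auto intro!: arg_cong[of _ _ F] simp: glue_def)

subsection \<open>Independence of the layers\<close>

definition layer_sites :: "nat \<Rightarrow> nat \<Rightarrow> nat set" where
  "layer_sites r n = (\<lambda>k. r * 2 ^ k) ` {..n}"

lemma finite_layer_sites: "finite (layer_sites r n)"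
  by (simp add: layer_sites_def)

lemma layer_sites_positive: "0 < r \<Longrightarrow> layer_sites r n \<subseteq> {1..}"
  by (auto simp: layer_sites_def Suc_le_eq)

lemma inj_layer_sites: "0 < (r :: nat) \<Longrightarrow> inj_on (\<lambda>k. r * 2 ^ k) A"
  by (auto simp: inj_on_def)

text \<open>If the exponents differed, the odd factor standing with the smaller one would be
  even.\<close>

lemma odd_times_power_of_2_unique:
  assumes "odd r" "odd r'" "r * 2 ^ k = r' * (2 :: nat) ^ k'"
  shows "r = r' \<and> k = k'"
proof -
  have "k = k'"
  proof (rule ccontr)
    assume "k \<noteq> k'"
    then consider "k < k'" | "k' < k"
      by linarith
    then show False
    proof cases
      case 1
      then obtain d where "k' = Suc (k + d)" by (blast dest: less_imp_Suc_add)
      then have "r = r' * 2 ^ Suc d" using assms(3) by (simp add: power_add)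
      then show False using assms(1) by simp
    next
      case 2
      then obtain d where "k = Suc (k' + d)" by (blast dest: less_imp_Suc_add)
      then have "r' = r * 2 ^ Suc d" using assms(3) by (simp add: power_add)
      then show False using assms(2) by simp
    qed
  qed
  then show ?thesis using assms(3) by simp
qed

lemma layer_glue_same: "k \<le> n \<Longrightarrow> layer r (glue (layer_sites r n) \<xi> \<omega>) k = \<xi> (r * 2 ^ k)"
  by (auto simp: layer_def glue_def layer_sites_def)

text \<open>Distinct layers are disjoint by uniqueness of the odd part; hence resampling one layer
  leaves functions of the others unchanged.\<close>

lemma layer_glue_other:
  assumes "odd r" "odd r'" "r \<noteq> r'"
  shows "layer r' (glue (layer_sites r n) \<xi> \<omega>) = layer r' \<omega>"
proof -
  have "r' * 2 ^ k \<notin> layer_sites r n" for k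
    using odd_times_power_of_2_unique[OF assms(2,1), of k] assms(3) by (auto simp: layer_sites_def)
  then show ?thesis by (simp add: layer_def glue_def)
qed

section \<open>The energy of a layer segment\<close>

lemma mult_ising_potential_singleton: "mult_ising_potential \<beta> J h {i} \<sigma> = - \<beta> * h * \<sigma> i"
  by (simp add: mult_ising_potential_def)

lemma mult_ising_potential_pair:
  assumes "0 < i"
  shows "mult_ising_potential \<beta> J h {i, 2 * i} \<sigma> = - \<beta> * J * \<sigma> i * \<sigma> (2 * i)"
proof -
  have "Min {i, 2 * i} = i" by (simp add: min_def)
  moreover have "{i, 2 * i} \<noteq> {i}" using assms by auto
  ultimately show ?thesis by (simp add: mult_ising_potential_def)
qed

text \<open>A pair \<open>{i, 2i}\<close> that meets the layer of \<open>r\<close> at \<open>2i\<close> also meets it at \<open>i\<close>, since \<open>r\<close> is odd.\<close>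

lemma local_energy_layer_sites:
  assumes "odd r"
  shows "local_energy (mult_ising_potential \<beta> J h) (layer_sites r n) \<sigma> =
     - (\<beta> * ((\<Sum>k\<le>n. J * layer r \<sigma> k * layer r \<sigma> (k + 1)) + (\<Sum>k\<le>n. h * layer r \<sigma> k)))"
proof -
  let ?U = "\<lambda>A. mult_ising_potential \<beta> J h A \<sigma>"
  let ?L = "layer_sites r n"
  let ?S = "{A. finite A \<and> A \<subseteq> {1..} \<and> A \<inter> ?L \<noteq> {}}"
  let ?T1 = "(\<lambda>i. {i}) ` ?L" and ?T2 = "(\<lambda>i. {i, 2 * i}) ` ?L"
  have r: "0 < r" using assms by (rule odd_pos)
  have L: "0 < i" if "i \<in> ?L" for i
    using that layer_sites_positive[OF r, of n] by auto
  \<comment> \<open>Among the sets that meet the segment, only its single sites and the bonds that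
    start in it contribute.\<close>
  have "infsum ?U ?S = infsum ?U (?T1 \<union> ?T2)"
  proof (rule infsum_cong_neutral)
    fix A assume "A \<in> (?T1 \<union> ?T2) - ?S"
    moreover have "?T1 \<union> ?T2 \<subseteq> ?S" using L by (auto simp: Suc_le_eq)
    ultimately show "?U A = 0" by blast
  next
    fix A assume A: "A \<in> ?S - (?T1 \<union> ?T2)"
    have "A \<noteq> {Min A}"
    proof
      define i where "i = Min A"
      assume "A = {Min A}"
      then have "A = {i}" by (simp add: i_def)
      then show False using A by auto
    qed
    moreover have "A \<noteq> {Min A, 2 * Min A}"
    proof
      define i where "i = Min A"
      assume "A = {Min A, 2 * Min A}"
      then have Ai: "A = {i, 2 * i}" by (simp add: i_def)
      then have "i \<notin> ?L" "2 * i \<in> ?L" using A by auto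
      then obtain k where k: "k \<le> n" "2 * i = r * 2 ^ k" by (auto simp: layer_sites_def)
      have "k \<noteq> 0" using k(2) assms by (metis dvd_triv_left mult.right_neutral power_0)
      then obtain l where "k = Suc l" by (cases k) auto
      with k have "i = r * 2 ^ l" "l \<le> n" by auto
      with \<open>i \<notin> ?L\<close> show False by (auto simp: layer_sites_def)
    qed
    ultimately show "?U A = 0" by (simp add: mult_ising_potential_def Let_def)
  qed auto
  also have "\<dots> = sum ?U (?T1 \<union> ?T2)"
    by (intro infsum_finite) (simp add: finite_layer_sites)
  also have "\<dots> = sum ?U ?T1 + sum ?U ?T2"
  proof (rule sum.union_disjoint)
    show "?T1 \<inter> ?T2 = {}"
    proof -
      have "{i} \<noteq> {j, 2 * j}" if "j \<in> ?L" for i j :: nat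
        using L[OF that] by (metis insertI1 insertI2 less_irrefl mult_2 add_eq_self_zero singletonD)
      then show ?thesis by blast
    qed
  qed (auto simp: finite_layer_sites)
  also have "sum ?U ?T1 = (\<Sum>i\<in>?L. - \<beta> * h * \<sigma> i)"
    by (subst sum.reindex) (auto simp: mult_ising_potential_singleton inj_on_def)
  also have "sum ?U ?T2 = (\<Sum>i\<in>?L. - \<beta> * J * \<sigma> i * \<sigma> (2 * i))"
  proof -
    have "inj_on (\<lambda>i::nat. {i, 2 * i}) ?L"
      by (auto simp: inj_on_def doubleton_eq_iff)
    then show ?thesis
      by (subst sum.reindex) (auto simp: mult_ising_potential_pair L)
  qed
  also have "(\<Sum>i\<in>?L. - \<beta> * h * \<sigma> i) = (\<Sum>k\<le>n. - \<beta> * h * layer r \<sigma> k)"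
    unfolding layer_sites_def by (subst sum.reindex) (auto simp: inj_layer_sites r layer_def)
  \<comment> \<open>There are \<open>n + 1\<close> bonds: the one for \<open>k = n\<close> leaves
    the segment.\<close>
  also have "(\<Sum>i\<in>?L. - \<beta> * J * \<sigma> i * \<sigma> (2 * i)) = (\<Sum>k\<le>n. - \<beta> * J * layer r \<sigma> k * layer r \<sigma> (k + 1))"
    unfolding layer_sites_def
    by (subst sum.reindex) (auto simp: inj_layer_sites r layer_def mult.left_commute intro!: sum.cong)
  finally show ?thesis
    by (simp add: local_energy_def sum_distrib_left sum_negf sum.distrib algebra_simps)
qed

lemma ising_weight_cong:
  assumes "\<And>k. k \<le> n \<Longrightarrow> \<eta> k = \<eta>' k"
  shows "ising_weight \<beta> J h s n \<eta> = ising_weight \<beta> J h s n \<eta>'"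
proof -
  have "(\<Sum>i<n. J * \<eta> i * \<eta> (i + 1)) = (\<Sum>i<n. J * \<eta>' i * \<eta>' (i + 1))"
       "(\<Sum>i\<le>n. h * \<eta> i) = (\<Sum>i\<le>n. h * \<eta>' i)"
    using assms by (auto intro!: sum.cong)
  then show ?thesis using assms[of n] by (simp add: ising_weight_def)
qed

text \<open>The bond that leaves the segment sees the outer spin of \<omega> and turns into the
  boundary term of the chain. Relabelling with \<open>restrict\<close> yields a member of
  \<open>configs {..n}\<close>, as the sums in \<open>ising_mean\<close> require.\<close>

lemma exp_local_energy_layer_sites:
  assumes "odd r"
  shows "exp (- local_energy (mult_ising_potential \<beta> J h) (layer_sites r n) (glue (layer_sites r n) \<xi> \<omega>)) =
     ising_weight \<beta> J h (J * \<omega> (r * 2 ^ Suc n)) n (\<lambda>k\<in>{..n}. \<xi> (r * 2 ^ k))"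
proof -
  let ?\<sigma> = "glue (layer_sites r n) \<xi> \<omega>"
  have "r * 2 ^ Suc n \<notin> layer_sites r n"
    using odd_pos[OF assms] by (auto simp: layer_sites_def simp del: power_Suc)
  then have b: "layer r ?\<sigma> (Suc n) = \<omega> (r * 2 ^ Suc n)"
    by (simp add: layer_def glue_def del: power_Suc)
  have "exp (- local_energy (mult_ising_potential \<beta> J h) (layer_sites r n) ?\<sigma>) =
      ising_weight \<beta> J h (J * \<omega> (r * 2 ^ Suc n)) n (layer r ?\<sigma>)"
    by (simp add: local_energy_layer_sites[OF assms] ising_weight_def b lessThan_Suc_atMost[symmetric]
        algebra_simps del: power_Suc)
  also have "\<dots> = ising_weight \<beta> J h (J * \<omega> (r * 2 ^ Suc n)) n (\<lambda>k\<in>{..n}. \<xi> (r * 2 ^ k))"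
    by (rule ising_weight_cong) (simp add: layer_glue_same)
  finally show ?thesis .
qed

text \<open>Carries sums over the spins of a layer segment to sums over the chain
  \<open>{..n}\<close>.\<close>

lemma sum_configs_reindex:
  assumes "inj_on \<phi> I"
  shows "(\<Sum>\<xi>\<in>configs (\<phi> ` I). (G (\<lambda>k\<in>I. \<xi> (\<phi> k)) :: real)) = (\<Sum>\<eta>\<in>configs I. G \<eta>)"
proof (rule sum.reindex_bij_witness[where i = "\<lambda>\<eta>. \<lambda>j\<in>\<phi> ` I. \<eta> (inv_into I \<phi> j)" and j = "\<lambda>\<xi>. \<lambda>k\<in>I. \<xi> (\<phi> k)"])
  fix \<xi> assume \<xi>: "\<xi> \<in> configs (\<phi> ` I)"
  then show "(\<lambda>j\<in>\<phi> ` I. (\<lambda>k\<in>I. \<xi> (\<phi> k)) (inv_into I \<phi> j)) = \<xi>"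
    by (intro ext) (auto simp: configs_def PiE_def extensional_def inv_into_f_f[OF assms])
  show "(\<lambda>k\<in>I. \<xi> (\<phi> k)) \<in> configs I"
    using \<xi> by (auto simp: configs_def PiE_iff)
next
  fix \<eta> assume \<eta>: "\<eta> \<in> configs I"
  then show "(\<lambda>k\<in>I. (\<lambda>j\<in>\<phi> ` I. \<eta> (inv_into I \<phi> j)) (\<phi> k)) = \<eta>"
    by (intro ext) (auto simp: configs_def PiE_def extensional_def inv_into_f_f[OF assms])
  show "(\<lambda>j\<in>\<phi> ` I. \<eta> (inv_into I \<phi> j)) \<in> configs (\<phi> ` I)"
    using \<eta> by (auto simp: configs_def PiE_iff inv_into_f_f[OF assms])
qed simp

section \<open>Measurability of gluing, spins and layers\<close>

lemma measurable_glue: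
  assumes "\<xi> \<in> configs \<Lambda>" "\<Lambda> \<subseteq> I"
  shows "glue \<Lambda> \<xi> \<in> measurable (config_space I) (config_space I)"
proof -
  have sp: "glue \<Lambda> \<xi> \<in> configs I \<rightarrow> configs I"
    using assms configs_spin[OF assms(1)]
    by (auto simp: configs_def[of I] glue_def PiE_iff extensional_def subset_iff)
  have "(\<lambda>\<omega> i. glue \<Lambda> \<xi> \<omega> i) \<in> measurable (config_space I) (Pi\<^sub>M I (\<lambda>_. count_space {-1, 1}))"
  proof (rule measurable_PiM_single')
    fix i assume "i \<in> I"
    show "(\<lambda>\<omega>. glue \<Lambda> \<xi> \<omega> i) \<in> measurable (config_space I) (count_space {-1, 1})"
    proof (cases "i \<in> \<Lambda>")
      case True
      then show ?thesis using configs_spin[OF assms(1) True] by (simp add: glue_def)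
    next
      case False
      then show ?thesis using \<open>i \<in> I\<close>
        by (simp add: glue_def config_space_def measurable_component_singleton)
    qed
  qed (use sp in \<open>auto simp: space_config_space configs_def\<close>)
  then show ?thesis by (simp add: config_space_def)
qed

lemma measurable_spin: "i \<in> I \<Longrightarrow> (\<lambda>\<omega>. \<omega> i) \<in> borel_measurable (config_space I)"
  unfolding config_space_def
  by (rule measurable_compose[OF measurable_component_singleton]) auto

lemma layer_Omega0: "0 < r \<Longrightarrow> \<sigma> \<in> Omega \<Longrightarrow> layer r \<sigma> \<in> Omega0"
proof -
  assume "0 < r" "\<sigma> \<in> Omega"
  then have "\<sigma> (r * 2 ^ i) = -1 \<or> \<sigma> (r * 2 ^ i) = 1" for i
    by (intro configs_spin) (auto simp: Suc_le_eq)
  then show ?thesis by (auto simp: configs_def layer_def)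
qed

lemma measurable_layer:
  assumes "0 < r"
  shows "layer r \<in> measurable (config_space {1..}) (config_space UNIV)"
proof -
  have "(\<lambda>\<sigma> i. layer r \<sigma> i) \<in> measurable (config_space {1..}) (Pi\<^sub>M UNIV (\<lambda>_. count_space {-1, 1}))"
  proof (rule measurable_PiM_single')
    fix i :: nat
    show "(\<lambda>\<sigma>. layer r \<sigma> i) \<in> measurable (config_space {1..}) (count_space {-1, 1})"
      unfolding layer_def config_space_def
      using assms by (intro measurable_component_singleton) (auto simp: Suc_le_eq)
  qed (use layer_Omega0[OF assms] in \<open>auto simp: space_config_space configs_def\<close>)
  then show ?thesis by (simp add: config_space_def)
qed

text \<open>The bound is uniform in \<open>n\<close> and \<open>s\<close>, as dominated convergence
  will need.\<close>

lemma abs_ising_mean_le: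
  assumes "\<And>\<eta>. \<eta> \<in> configs {..n} \<Longrightarrow> \<bar>g \<eta>\<bar> \<le> B"
  shows "\<bar>ising_mean \<beta> J h s n g\<bar> \<le> B"
proof -
  have "\<bar>\<Sum>\<eta>\<in>configs {..n}. g \<eta> * ising_weight \<beta> J h s n \<eta>\<bar> \<le> (\<Sum>\<eta>\<in>configs {..n}. B * ising_weight \<beta> J h s n \<eta>)"
    using assms less_imp_le[OF ising_weight_pos]
    by (intro order_trans[OF sum_abs] sum_mono) (auto simp: abs_mult intro!: mult_right_mono)
  then show ?thesis
    using sum_ising_weight_pos[of \<beta> J h s n]
    by (simp add: ising_mean_def abs_div_pos[symmetric] pos_divide_le_eq sum_distrib_left)
qed

section \<open>Splitting off a layer\<close>

lemma sets_mult_ising_measure: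
  "is_mult_ising_measure \<beta> J h \<mu> \<Longrightarrow> sets \<mu> = sets (config_space {1..})"
  by (simp add: is_mult_ising_measure_def is_gibbs_measure_def)

lemma sets_ising_measure:
  "is_ising_measure \<beta> J h \<mu> \<Longrightarrow> sets \<mu> = sets (config_space UNIV)"
  by (simp add: is_ising_measure_def)

text \<open>The DLR equation for the first \<open>n + 1\<close> sites of layer \<open>r\<close>. The
  factor \<open>G\<close> depends on other sites and passes through the kernel; what remains is the
  mean of a finite chain whose boundary field is set by the next spin of the layer.\<close>

lemma dlr_layer:
  assumes M: "is_mult_ising_measure \<beta> J h \<mu>M" and r: "odd r" and mn: "m \<le> n"
    and F: "continuous_on Omega0 F" "\<And>\<tau>. \<tau> \<in> Omega0 \<Longrightarrow> 0 \<le> F \<tau>"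
    and G: "G \<in> borel_measurable \<mu>M" "\<And>\<omega>. \<omega> \<in> Omega \<Longrightarrow> 0 \<le> G \<omega>"
    and GL: "\<And>\<xi> \<omega>. G (glue (layer_sites r n) \<xi> \<omega>) = G \<omega>"
  shows "(\<integral>\<sigma>. F (glue {..m} (layer r \<sigma>) (\<lambda>_. 1)) * G \<sigma> \<partial>\<mu>M) =
     (\<integral>\<sigma>. ising_mean \<beta> J h (J * \<sigma> (r * 2 ^ Suc n)) n (\<lambda>\<eta>. F (glue {..m} \<eta> (\<lambda>_. 1))) * G \<sigma> \<partial>\<mu>M)"
proof -
  define L where "L = layer_sites r n"
  define s where "s \<omega> = J * \<omega> (r * 2 ^ Suc n)" for \<omega> :: "nat \<Rightarrow> real"
  define e where "e \<xi> = (\<lambda>k\<in>{..n}. \<xi> (r * 2 ^ k))" for \<xi> :: "nat \<Rightarrow> real"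
  define Z where "Z \<omega> = (\<Sum>\<eta>\<in>configs {..n}. ising_weight \<beta> J h (s \<omega>) n \<eta>)" for \<omega>
  let ?W = "\<lambda>\<xi> \<omega>. exp (- local_energy (mult_ising_potential \<beta> J h) L (glue L \<xi> \<omega>))"
  let ?c = "\<lambda>\<xi> \<omega>. ising_weight \<beta> J h (s \<omega>) n (e \<xi>) / Z \<omega>"
  let ?F = "\<lambda>\<eta>. F (glue {..m} \<eta> (\<lambda>_. 1))"
  have r0: "0 < r" using r by (rule odd_pos)
  have sets: "sets \<mu>M = sets (config_space {1..})" using M by (rule sets_mult_ising_measure)
  have sp: "space \<mu>M = Omega" using sets_eq_imp_space_eq[OF sets] by (simp add: space_config_space)
  have W: "?W \<xi> \<omega> = ising_weight \<beta> J h (s \<omega>) n (e \<xi>)" for \<xi> \<omega>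
    using exp_local_energy_layer_sites[OF r] by (simp add: L_def s_def e_def)
  have reindex: "(\<Sum>\<xi>\<in>configs L. H (e \<xi>)) = (\<Sum>\<eta>\<in>configs {..n}. H \<eta>)" for H :: "_ \<Rightarrow> real"
    unfolding L_def layer_sites_def e_def by (rule sum_configs_reindex[OF inj_layer_sites[OF r0]])
  have Z: "(\<Sum>\<xi>\<in>configs L. ising_weight \<beta> J h (s \<omega>) n (e \<xi>)) = Z \<omega>" for \<omega>
    unfolding Z_def by (rule reindex)
  have Z0: "0 < Z \<omega>" for \<omega> unfolding Z_def by (rule sum_ising_weight_pos)
  have fin: "finite (configs L)" by (simp add: L_def finite_layer_sites finite_configs)
  have s_meas: "s \<in> borel_measurable \<mu>M"
    unfolding s_def measurable_cong_sets[OF sets refl]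
    using r0 by (intro borel_measurable_times measurable_spin borel_measurable_const) (auto simp: Suc_le_eq)
  have w_meas: "(\<lambda>\<omega>. ising_weight \<beta> J h (s \<omega>) n \<eta>) \<in> borel_measurable \<mu>M" for \<eta>
    unfolding ising_weight_def using s_meas by measurable
  have "(\<integral>\<sigma>. ?F (layer r \<sigma>) * G \<sigma> \<partial>\<mu>M) =
      (\<integral>\<omega>. (\<Sum>\<xi>\<in>configs L. (?F (layer r (glue L \<xi> \<omega>)) * G (glue L \<xi> \<omega>)) * ?c \<xi> \<omega>) \<partial>\<mu>M)"
  proof (rule dlr_integral[OF _ fin])
    show "prob_space \<mu>M" using M by (simp add: is_mult_ising_measure_def is_gibbs_measure_def)
  next
    fix \<xi> assume \<xi>: "\<xi> \<in> configs L"
    show "glue L \<xi> \<in> measurable \<mu>M \<mu>M"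
      unfolding measurable_cong_sets[OF sets sets]
      using \<xi> layer_sites_positive[OF r0] by (intro measurable_glue) (auto simp: L_def)
    show "?c \<xi> \<in> borel_measurable \<mu>M"
      unfolding Z_def by (intro borel_measurable_divide borel_measurable_sum w_meas)
    show "0 \<le> ?c \<xi> \<omega>" for \<omega>
      using less_imp_le[OF ising_weight_pos] less_imp_le[OF Z0] by (intro divide_nonneg_nonneg) auto
    show "?c \<xi> \<omega> \<le> 1" for \<omega>
    proof -
      have "ising_weight \<beta> J h (s \<omega>) n (e \<xi>) \<le> Z \<omega>"
        unfolding Z[symmetric] using \<xi> fin less_imp_le[OF ising_weight_pos] by (intro member_le_sum) auto
      then show ?thesis using Z0[of \<omega>] by simp
    qed
  next
    fix B assume B: "B \<in> sets \<mu>M"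
    have "measure \<mu>M B = (\<integral>\<omega>. gibbs_kernel (mult_ising_potential \<beta> J h) L B \<omega> \<partial>\<mu>M)"
      using M B layer_sites_positive[OF r0, of n] finite_layer_sites[of r n]
      unfolding is_mult_ising_measure_def is_gibbs_measure_def L_def by blast
    also have "\<dots> = (\<integral>\<omega>. (\<Sum>\<xi>\<in>configs L. indicator B (glue L \<xi> \<omega>) * ?c \<xi> \<omega>) \<partial>\<mu>M)"
      unfolding gibbs_kernel_def W Z by (simp add: sum_divide_distrib)
    finally show "measure \<mu>M B = (\<integral>\<omega>. (\<Sum>\<xi>\<in>configs L. indicator B (glue L \<xi> \<omega>) * ?c \<xi> \<omega>) \<partial>\<mu>M)" .
  next
    have "(\<lambda>\<sigma>. ?F (layer r \<sigma>)) \<in> borel_measurable \<mu>M"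
      unfolding measurable_cong_sets[OF sets refl]
      by (rule measurable_compose[OF measurable_layer[OF r0] measurable_cut])
    then show "(\<lambda>\<sigma>. ?F (layer r \<sigma>) * G \<sigma>) \<in> borel_measurable \<mu>M"
      using G(1) by (rule borel_measurable_times)
  next
    fix \<sigma> assume "\<sigma> \<in> space \<mu>M"
    then show "0 \<le> ?F (layer r \<sigma>) * G \<sigma>"
      by (auto simp: sp G F(2) cut_Omega0[of _ UNIV] layer_Omega0[OF r0])
  qed
  also have "\<dots> = (\<integral>\<sigma>. ising_mean \<beta> J h (s \<sigma>) n ?F * G \<sigma> \<partial>\<mu>M)"
  proof (rule Bochner_Integration.integral_cong[OF refl])
    fix \<omega>
    \<comment> \<open>As \<open>m \<le> n\<close>, the cut reads resampled spins only, so \<omega>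
      drops out.\<close>
    have "?F (layer r (glue L \<xi> \<omega>)) = ?F (e \<xi>)" for \<xi>
      using layer_glue_same[of _ n r \<xi> \<omega>] mn
      by (intro arg_cong[of _ _ F]) (auto simp: glue_def e_def L_def)
    then have "(\<Sum>\<xi>\<in>configs L. (?F (layer r (glue L \<xi> \<omega>)) * G (glue L \<xi> \<omega>)) * ?c \<xi> \<omega>) =
        (\<Sum>\<xi>\<in>configs L. ?F (e \<xi>) * ising_weight \<beta> J h (s \<omega>) n (e \<xi>)) * (G \<omega> / Z \<omega>)"
      using GL by (simp add: L_def sum_distrib_right sum_distrib_left sum_divide_distrib mult_ac)
    also have "\<dots> = ising_mean \<beta> J h (s \<omega>) n ?F * G \<omega>"
      unfolding reindex[of "\<lambda>\<eta>. ?F \<eta> * ising_weight \<beta> J h (s \<omega>) n \<eta>"] ising_mean_def Z_def by simp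
    finally show "(\<Sum>\<xi>\<in>configs L. (?F (layer r (glue L \<xi> \<omega>)) * G (glue L \<xi> \<omega>)) * ?c \<xi> \<omega>) =
        ising_mean \<beta> J h (s \<omega>) n ?F * G \<omega>" .
  qed
  finally show ?thesis by (simp add: s_def)
qed

text \<open>First \<open>n\<close> tends to infinity in \<open>dlr_layer\<close>, where the chain
  mean becomes the constant Ising expectation; then \<open>m\<close> does, to pass from cuts to
  \<open>F\<close>. The bounds on \<open>F\<close> and \<open>G\<close> dominate both
  limits.\<close>

lemma integral_layer_mult:
  fixes F G :: "(nat \<Rightarrow> real) \<Rightarrow> real"
  assumes M: "is_mult_ising_measure \<beta> J h \<mu>M" and I: "is_ising_measure \<beta> J h \<mu>I" and r: "odd r"
    and F: "continuous_on Omega0 F" "\<And>\<tau>. \<tau> \<in> Omega0 \<Longrightarrow> 0 \<le> F \<tau>"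
    and G: "G \<in> borel_measurable \<mu>M" "\<And>\<omega>. \<omega> \<in> Omega \<Longrightarrow> 0 \<le> G \<omega>" "\<And>\<omega>. \<omega> \<in> Omega \<Longrightarrow> G \<omega> \<le> C"
    and GL: "\<And>n \<xi> \<omega>. G (glue (layer_sites r n) \<xi> \<omega>) = G \<omega>"
  shows "(\<integral>\<sigma>. F (layer r \<sigma>) * G \<sigma> \<partial>\<mu>M) = (\<integral>\<tau>. F \<tau> \<partial>\<mu>I) * (\<integral>\<sigma>. G \<sigma> \<partial>\<mu>M)"
proof -
  have r0: "0 < r" using r by (rule odd_pos)
  have setsM: "sets \<mu>M = sets (config_space {1..})" using M by (rule sets_mult_ising_measure)
  have spM: "space \<mu>M = Omega" using sets_eq_imp_space_eq[OF setsM] by (simp add: space_config_space)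
  have setsI: "sets \<mu>I = sets (config_space UNIV)" using I by (rule sets_ising_measure)
  have spI: "space \<mu>I = Omega0" using sets_eq_imp_space_eq[OF setsI] by (simp add: space_config_space)
  interpret M: prob_space \<mu>M using M by (simp add: is_mult_ising_measure_def is_gibbs_measure_def)
  interpret I: prob_space \<mu>I using I by (simp add: is_ising_measure_def)
  obtain B where B: "0 \<le> B" "\<And>\<tau>. \<tau> \<in> Omega0 \<Longrightarrow> \<bar>F \<tau>\<bar> \<le> B"
    using bounded_on_Omega0[OF F(1)] by metis
  have C: "0 \<le> C"
    using G(2,3) configs_not_empty[of "{1..}"] by (metis ex_in_conv order_trans)
  let ?cut = "\<lambda>m \<tau>. F (glue {..m} \<tau> (\<lambda>_. 1))"
  have cut: "(\<integral>\<sigma>. ?cut m (layer r \<sigma>) * G \<sigma> \<partial>\<mu>M) = (\<integral>\<tau>. ?cut m \<tau> \<partial>\<mu>I) * (\<integral>\<sigma>. G \<sigma> \<partial>\<mu>M)" for m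
  proof -
    let ?mean = "\<lambda>t n. ising_mean \<beta> J h (J * t) n (?cut m)"
    \<comment> \<open>The chain length is shifted by \<open>m\<close> so that
      \<open>dlr_layer\<close> applies for every \<open>n\<close>.\<close>
    let ?s = "\<lambda>n \<sigma>. ?mean (\<sigma> (r * 2 ^ Suc (n + m))) (n + m) * G \<sigma>"
    define K where "K = (\<integral>\<tau>. ?cut m \<tau> \<partial>\<mu>I)"
    have mean_lim: "(\<lambda>n. ?mean t (n + m)) \<longlonglongrightarrow> K" for t
      unfolding K_def by (rule LIMSEQ_ignore_initial_segment[OF ising_mean_tendsto[OF I F(1)]])
    have "(\<lambda>n. \<integral>\<sigma>. ?s n \<sigma> \<partial>\<mu>M) \<longlonglongrightarrow> (\<integral>\<sigma>. K * G \<sigma> \<partial>\<mu>M)"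
    proof (rule integral_dominated_convergence[where w = "\<lambda>_. B * C"])
      show "(\<lambda>\<sigma>. K * G \<sigma>) \<in> borel_measurable \<mu>M" using G(1) by simp
      show "?s n \<in> borel_measurable \<mu>M" for n
      proof (intro borel_measurable_times G(1))
        have "(\<lambda>\<sigma>. \<sigma> (r * 2 ^ Suc (n + m))) \<in> borel_measurable \<mu>M"
          unfolding measurable_cong_sets[OF setsM refl]
          using r0 by (intro measurable_spin) (auto simp: Suc_le_eq)
        then show "(\<lambda>\<sigma>. ?mean (\<sigma> (r * 2 ^ Suc (n + m))) (n + m)) \<in> borel_measurable \<mu>M"
          unfolding ising_mean_def ising_weight_def by measurable
      qed
      show "AE \<sigma> in \<mu>M. norm (?s n \<sigma>) \<le> B * C" for n
      proof (rule AE_I2)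
        fix \<sigma> assume "\<sigma> \<in> space \<mu>M"
        moreover have "\<bar>?mean (\<sigma> (r * 2 ^ Suc (n + m))) (n + m)\<bar> \<le> B"
          by (intro abs_ising_mean_le B(2) cut_Omega0) auto
        ultimately show "norm (?s n \<sigma>) \<le> B * C"
          using G(2,3) B(1) by (auto simp: spM abs_mult intro!: mult_mono)
      qed
      show "AE \<sigma> in \<mu>M. (\<lambda>n. ?s n \<sigma>) \<longlonglongrightarrow> K * G \<sigma>"
      proof (rule AE_I2, rule tendsto_mult_right)
        fix \<sigma> assume \<sigma>: "\<sigma> \<in> space \<mu>M"
        \<comment> \<open>The boundary spin varies with \<open>n\<close>, so no single field can be
          fixed; the error is bounded by the sum of the errors for both spin values.\<close>
        have bound: "norm (?mean (\<sigma> (r * 2 ^ Suc (n + m))) (n + m) - K) \<le> \<bar>?mean 1 (n + m) - K\<bar> + \<bar>?mean (-1) (n + m) - K\<bar>" for n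
        proof -
          have "\<sigma> (r * 2 ^ Suc (n + m)) = -1 \<or> \<sigma> (r * 2 ^ Suc (n + m)) = 1"
            using \<sigma> r0 by (intro configs_spin[where I = "{1..}"]) (auto simp: spM Suc_le_eq)
          then show ?thesis by (elim disjE) (simp_all only: real_norm_def abs_ge_zero le_add_same_cancel1 le_add_same_cancel2)
        qed
        have "(\<lambda>n. \<bar>?mean 1 (n + m) - K\<bar> + \<bar>?mean (-1) (n + m) - K\<bar>) \<longlonglongrightarrow> 0"
          using mean_lim by (intro tendsto_add_zero tendsto_rabs_zero) (simp_all only: LIM_zero_iff)
        with always_eventually[OF allI[OF bound]]
        have "(\<lambda>n. ?mean (\<sigma> (r * 2 ^ Suc (n + m))) (n + m) - K) \<longlonglongrightarrow> 0"
          by (rule Lim_null_comparison)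
        then show "(\<lambda>n. ?mean (\<sigma> (r * 2 ^ Suc (n + m))) (n + m)) \<longlonglongrightarrow> K"
          by (simp only: LIM_zero_iff)
      qed
    qed simp
    \<comment> \<open>By \<open>dlr_layer\<close> the integrals do not depend on \<open>n\<close>,
      so they equal their limit.\<close>
    moreover have "(\<integral>\<sigma>. ?s n \<sigma> \<partial>\<mu>M) = (\<integral>\<sigma>. ?cut m (layer r \<sigma>) * G \<sigma> \<partial>\<mu>M)" for n
      by (rule dlr_layer[OF M r _ F G(1,2) GL, symmetric]) simp_all
    ultimately have "(\<lambda>n. \<integral>\<sigma>. ?cut m (layer r \<sigma>) * G \<sigma> \<partial>\<mu>M) \<longlonglongrightarrow> (\<integral>\<sigma>. K * G \<sigma> \<partial>\<mu>M)"
      by simp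
    then show ?thesis
      by (simp add: LIMSEQ_const_iff K_def)
  qed
  have "(\<lambda>m. \<integral>\<sigma>. ?cut m (layer r \<sigma>) * G \<sigma> \<partial>\<mu>M) \<longlonglongrightarrow> (\<integral>\<sigma>. F (layer r \<sigma>) * G \<sigma> \<partial>\<mu>M)"
  proof (rule integral_dominated_convergence[where w = "\<lambda>_. B * C"])
    show "(\<lambda>\<sigma>. F (layer r \<sigma>) * G \<sigma>) \<in> borel_measurable \<mu>M"
      using measurable_compose[OF measurable_layer[OF r0] continuous_imp_measurable[OF F(1)]] G(1)
      unfolding measurable_cong_sets[OF setsM refl] by (rule borel_measurable_times)
    show "(\<lambda>\<sigma>. ?cut m (layer r \<sigma>) * G \<sigma>) \<in> borel_measurable \<mu>M" for m
      using measurable_compose[OF measurable_layer[OF r0] measurable_cut] G(1)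
      unfolding measurable_cong_sets[OF setsM refl] by (rule borel_measurable_times)
    show "AE \<sigma> in \<mu>M. (\<lambda>m. ?cut m (layer r \<sigma>) * G \<sigma>) \<longlonglongrightarrow> F (layer r \<sigma>) * G \<sigma>"
      by (intro AE_I2 tendsto_mult_right cut_tendsto F(1) layer_Omega0 r0) (simp add: spM)
    show "AE \<sigma> in \<mu>M. norm (?cut m (layer r \<sigma>) * G \<sigma>) \<le> B * C" for m
      using G(2,3) B
      by (intro AE_I2) (auto simp: spM abs_mult cut_Omega0[of _ UNIV] layer_Omega0[OF r0] intro!: mult_mono)
  qed simp
  moreover have "(\<lambda>m. \<integral>\<tau>. ?cut m \<tau> \<partial>\<mu>I) \<longlonglongrightarrow> (\<integral>\<tau>. F \<tau> \<partial>\<mu>I)"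
  proof (rule integral_dominated_convergence[where w = "\<lambda>_. B"])
    show "F \<in> borel_measurable \<mu>I"
      using continuous_imp_measurable[OF F(1)] unfolding measurable_cong_sets[OF setsI refl] .
    show "?cut m \<in> borel_measurable \<mu>I" for m
      using measurable_cut unfolding measurable_cong_sets[OF setsI refl] .
    show "AE \<tau> in \<mu>I. (\<lambda>m. ?cut m \<tau>) \<longlonglongrightarrow> F \<tau>"
      by (intro AE_I2 cut_tendsto F(1)) (simp add: spI)
    show "AE \<tau> in \<mu>I. norm (?cut m \<tau>) \<le> B" for m
      using B by (intro AE_I2) (auto simp: spI cut_Omega0[of _ UNIV])
  qed simp
  then have "(\<lambda>m. \<integral>\<sigma>. ?cut m (layer r \<sigma>) * G \<sigma> \<partial>\<mu>M) \<longlonglongrightarrow> (\<integral>\<tau>. F \<tau> \<partial>\<mu>I) * (\<integral>\<sigma>. G \<sigma> \<partial>\<mu>M)"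
    unfolding cut by (rule tendsto_mult_right)
  ultimately show ?thesis by (rule LIMSEQ_unique)
qed

text \<open>Induction on \<open>R\<close>: the product over the remaining layers plays the role of
  \<open>G\<close> in \<open>integral_layer_mult\<close>, bounded by the product of the bounds of
  its factors.\<close>

lemma integral_prod_layers:
  fixes F :: "nat \<Rightarrow> (nat \<Rightarrow> real) \<Rightarrow> real"
  assumes M: "is_mult_ising_measure \<beta> J h \<mu>M" and I: "is_ising_measure \<beta> J h \<mu>I"
    and "finite R" "\<And>r. r \<in> R \<Longrightarrow> odd r"
    and F: "\<And>r. r \<in> R \<Longrightarrow> continuous_on Omega0 (F r)"
      "\<And>r \<tau>. r \<in> R \<Longrightarrow> \<tau> \<in> Omega0 \<Longrightarrow> 0 \<le> F r \<tau>"
  shows "(\<integral>\<sigma>. (\<Prod>r\<in>R. F r (layer r \<sigma>)) \<partial>\<mu>M) = (\<Prod>r\<in>R. \<integral>\<tau>. F r \<tau> \<partial>\<mu>I)"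
  using assms(3-)
proof (induction R)
  case empty
  interpret prob_space \<mu>M using M by (simp add: is_mult_ising_measure_def is_gibbs_measure_def)
  show ?case by (simp add: prob_space)
next
  case (insert r R)
  have setsM: "sets \<mu>M = sets (config_space {1..})" using M by (rule sets_mult_ising_measure)
  have odd_R: "odd r'" "r' \<noteq> r" "0 < r'" if "r' \<in> R" for r'
    using insert.hyps insert.prems(1)[of r'] that odd_pos by auto
  have "\<exists>B. \<forall>\<tau>\<in>Omega0. F r' \<tau> \<le> B" if "r' \<in> R" for r'
  proof -
    have "continuous_on Omega0 (F r')" using insert.prems(2) that by simp
    then obtain B where "\<And>\<tau>. \<tau> \<in> Omega0 \<Longrightarrow> \<bar>F r' \<tau>\<bar> \<le> B" using bounded_on_Omega0 by metis
    then show ?thesis by (intro exI[of _ B]) (auto intro: order_trans[OF abs_ge_self])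
  qed
  then obtain B where B: "\<And>r' \<tau>. r' \<in> R \<Longrightarrow> \<tau> \<in> Omega0 \<Longrightarrow> F r' \<tau> \<le> B r'" by metis
  have "(\<integral>\<sigma>. (\<Prod>r'\<in>insert r R. F r' (layer r' \<sigma>)) \<partial>\<mu>M) =
      (\<integral>\<sigma>. F r (layer r \<sigma>) * (\<Prod>r'\<in>R. F r' (layer r' \<sigma>)) \<partial>\<mu>M)"
    using insert.hyps by simp
  also have "\<dots> = (\<integral>\<tau>. F r \<tau> \<partial>\<mu>I) * (\<integral>\<sigma>. (\<Prod>r'\<in>R. F r' (layer r' \<sigma>)) \<partial>\<mu>M)"
  proof (rule integral_layer_mult[OF M I, where C = "\<Prod>r'\<in>R. B r'"])
    show "odd r" using insert.prems(1) by simp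
    show "continuous_on Omega0 (F r)" "\<And>\<tau>. \<tau> \<in> Omega0 \<Longrightarrow> 0 \<le> F r \<tau>" using insert.prems by auto
    show "(\<lambda>\<sigma>. \<Prod>r'\<in>R. F r' (layer r' \<sigma>)) \<in> borel_measurable \<mu>M"
      unfolding measurable_cong_sets[OF setsM refl]
    proof (rule borel_measurable_prod)
      fix r' assume "r' \<in> R"
      then show "(\<lambda>\<sigma>. F r' (layer r' \<sigma>)) \<in> borel_measurable (config_space {1..})"
        using insert.prems(2) odd_R
        by (intro measurable_compose[OF measurable_layer continuous_imp_measurable]) auto
    qed
    fix \<omega> :: "nat \<Rightarrow> real"
    show "(\<Prod>r'\<in>R. F r' (layer r' (glue (layer_sites r n) \<xi> \<omega>))) = (\<Prod>r'\<in>R. F r' (layer r' \<omega>))" for n \<xi>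
      using odd_R insert.prems(1)[of r] by (intro prod.cong refl arg_cong[of _ _ "F _"] layer_glue_other) auto
    assume \<omega>: "\<omega> \<in> Omega"
    show "0 \<le> (\<Prod>r'\<in>R. F r' (layer r' \<omega>))"
      using \<omega> insert.prems(3) odd_R by (intro prod_nonneg) (auto simp: layer_Omega0)
    show "(\<Prod>r'\<in>R. F r' (layer r' \<omega>)) \<le> (\<Prod>r'\<in>R. B r')"
      using \<omega> insert.prems(3) odd_R B by (intro prod_mono) (auto simp: layer_Omega0)
  qed
  also have "(\<integral>\<sigma>. (\<Prod>r'\<in>R. F r' (layer r' \<sigma>)) \<partial>\<mu>M) = (\<Prod>r'\<in>R. \<integral>\<tau>. F r' \<tau> \<partial>\<mu>I)"
    using insert by simp
  finally show ?case using insert.hyps by simp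
qed

subsection \<open>Counting layers by length\<close>

lemma ex_odd_times_power_of_2:
  assumes "0 < (i :: nat)"
  obtains r k where "odd r" "i = r * 2 ^ k"
proof -
  have "i \<noteq> 0" "\<not> is_unit (2 :: nat)" using assms by auto
  then obtain y where "i = 2 ^ multiplicity 2 i * y" "odd y" by (rule multiplicity_decompose')
  then show thesis by (intro that[of y "multiplicity 2 i"]) (auto simp: mult.commute)
qed

text \<open>The odd numbers whose layers have exactly \<open>k + 1\<close> sites in \<open>{1..N}\<close>.\<close>

definition top_odds :: "nat \<Rightarrow> nat \<Rightarrow> nat set" where
  "top_odds N k = {r. odd r \<and> r * 2 ^ k \<le> N \<and> N < r * 2 ^ Suc k}"

lemma finite_powers_le: "0 < r \<Longrightarrow> finite {k. r * 2 ^ k \<le> (N :: nat)}"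
proof (rule finite_subset)
  assume "0 < r"
  have "k \<le> N" if "r * 2 ^ k \<le> N" for k
  proof -
    have "k < 2 ^ k" by (rule less_exp)
    also have "2 ^ k \<le> r * 2 ^ k" using \<open>0 < r\<close> by simp
    finally show ?thesis using that by simp
  qed
  then show "{k. r * 2 ^ k \<le> N} \<subseteq> {..N}" by auto
qed simp

text \<open>The map \<open>(r, k) \<mapsto> r * 2 ^ k\<close> is a bijection onto the positive
  integers when \<open>r\<close> is odd.\<close>

lemma sum_odd_times_power_of_2:
  "(\<Sum>i=1..N. g i) = (\<Sum>r::nat | odd r \<and> r \<le> N. \<Sum>k | r * 2 ^ k \<le> N. g (r * 2 ^ k) :: real)"
proof -
  let ?S = "SIGMA r:{r::nat. odd r \<and> r \<le> N}. {k. r * 2 ^ k \<le> N}"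
  let ?\<phi> = "\<lambda>(r, k). r * 2 ^ k :: nat"
  have inj: "inj_on ?\<phi> ?S"
    by (auto simp: inj_on_def dest: odd_times_power_of_2_unique)
  have "{1..N} \<subseteq> ?\<phi> ` ?S"
  proof
    fix i assume i: "i \<in> {1..N}"
    then obtain r k where rk: "odd r" "i = r * 2 ^ k" using ex_odd_times_power_of_2[of i] by auto
    have "r \<le> r * 2 ^ k" by simp
    also have "\<dots> \<le> N" using i rk by simp
    finally have "(r, k) \<in> ?S" using i rk by simp
    with rk show "i \<in> ?\<phi> ` ?S" by force
  qed
  moreover have "?\<phi> ` ?S \<subseteq> {1..N}" by (auto simp: Suc_le_eq odd_pos)
  ultimately have "{1..N} = ?\<phi> ` ?S" by (rule antisym)
  then have "(\<Sum>i=1..N. g i) = (\<Sum>(r, k)\<in>?S. g (r * 2 ^ k))"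
    using inj by (simp add: sum.reindex o_def case_prod_unfold)
  also have "\<dots> = (\<Sum>r | odd r \<and> r \<le> N. \<Sum>k | r * 2 ^ k \<le> N. g (r * 2 ^ k))"
    by (rule sum.Sigma[symmetric]) (auto simp: finite_powers_le odd_pos)
  finally show ?thesis .
qed

lemma powers_le_top_odds:
  assumes "r \<in> top_odds N k"
  shows "{j. r * 2 ^ j \<le> N} = {0..k}"
proof (intro set_eqI iffI)
  have r: "0 < r" "r * 2 ^ k \<le> N" "N < r * 2 ^ Suc k" using assms by (auto simp: top_odds_def odd_pos)
  fix j
  show "j \<in> {0..k}" if "j \<in> {j. r * 2 ^ j \<le> N}"
  proof (rule ccontr)
    assume "j \<notin> {0..k}"
    then have "r * 2 ^ Suc k \<le> r * 2 ^ j" by (intro mult_le_mono2 power_increasing) auto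
    with that r show False by simp
  qed
  show "j \<in> {j. r * 2 ^ j \<le> N}" if "j \<in> {0..k}"
  proof -
    have "r * 2 ^ j \<le> r * 2 ^ k" using that by (intro mult_le_mono2 power_increasing) auto
    with r(2) show ?thesis by (simp only: mem_Collect_eq)
  qed
qed

lemma odd_le_eq_UN_top_odds: "{r. odd r \<and> r \<le> N} = (\<Union>k\<in>{..N}. top_odds N k)"
proof (intro antisym subsetI)
  fix r assume "r \<in> {r. odd r \<and> r \<le> N}"
  then have r: "odd r" "r \<le> N" by auto
  let ?K = "{k. r * 2 ^ k \<le> N}"
  have K: "finite ?K" "0 \<in> ?K" using r by (auto simp: finite_powers_le odd_pos)
  \<comment> \<open>The class of \<open>r\<close> is given by the last site of its layer inside
    \<open>{1..N}\<close>; \<open>k \<le> N\<close> follows from \<open>k < 2 ^ k\<close>.\<close>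
  define k where "k = Max ?K"
  have "k \<in> ?K" unfolding k_def using K by (intro Max_in) blast+
  moreover have "Suc k \<notin> ?K" using Max_ge[OF K(1), of "Suc k"] unfolding k_def by linarith
  moreover have "k \<le> N"
  proof -
    have "k < 2 ^ k" by (rule less_exp)
    also have "2 ^ k \<le> r * 2 ^ k" using odd_pos[OF r(1)] by simp
    finally show ?thesis using \<open>k \<in> ?K\<close> by simp
  qed
  ultimately show "r \<in> (\<Union>k\<in>{..N}. top_odds N k)" using r by (auto simp: top_odds_def)
next
  fix r assume "r \<in> (\<Union>k\<in>{..N}. top_odds N k)"
  then obtain k where "odd r" "r * 2 ^ k \<le> N" by (auto simp: top_odds_def)
  moreover have "r \<le> r * 2 ^ k" by simp
  ultimately have "r \<le> N" by linarith
  with \<open>odd r\<close> show "r \<in> {r. odd r \<and> r \<le> N}" by simp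
qed

lemma top_odds_subset: "top_odds N k \<subseteq> {1..N div 2 ^ k}"
  by (auto simp: top_odds_def less_eq_div_iff_mult_less_eq Suc_le_eq odd_pos)

lemma finite_top_odds: "finite (top_odds N k)"
  using top_odds_subset finite_subset by blast

lemma top_odds_empty: "N < k \<Longrightarrow> top_odds N k = {}"
proof -
  assume "N < k"
  also have "k < 2 ^ k" by (rule less_exp)
  finally have "N div 2 ^ k = 0" by simp
  then show ?thesis using top_odds_subset[of N k] by simp
qed

text \<open>The summand depends on \<open>r\<close> only through its set of exponents, which is
  \<open>{0..k}\<close> throughout the class \<open>top_odds N k\<close>; hence \<open>g\<close>
  takes sets as arguments.\<close>

lemma sum_odd_le_top_odds:
  "(\<Sum>r | odd r \<and> r \<le> N. g {k. r * 2 ^ k \<le> N}) = (\<Sum>k\<le>N. real (card (top_odds N k)) * g {0..k})"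
proof -
  have "top_odds N k \<inter> top_odds N k' = {}" if "k \<noteq> k'" for k k'
  proof -
    have "k = k'" if "r \<in> top_odds N k" "r \<in> top_odds N k'" for r
      using powers_le_top_odds[OF that(1)] powers_le_top_odds[OF that(2)] by simp
    with that show ?thesis by auto
  qed
  then have "(\<Sum>r | odd r \<and> r \<le> N. g {k. r * 2 ^ k \<le> N}) =
      (\<Sum>k\<le>N. \<Sum>r\<in>top_odds N k. g {k. r * 2 ^ k \<le> N})"
    unfolding odd_le_eq_UN_top_odds by (intro sum.UNION_disjoint) (auto simp: finite_top_odds)
  also have "\<dots> = (\<Sum>k\<le>N. real (card (top_odds N k)) * g {0..k})"
    by (intro sum.cong refl) (simp add: powers_le_top_odds)
  finally show ?thesis .
qed

section \<open>Densities of the classes\<close>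

lemma card_odd_le: "card {r. odd r \<and> r \<le> (x :: nat)} = (x + 1) div 2"
proof -
  have "{r. odd r \<and> r \<le> x} = (\<lambda>j. 2 * j + 1) ` {..<(x + 1) div 2}"
  proof (intro antisym subsetI)
    fix r assume "r \<in> {r. odd r \<and> r \<le> x}"
    then obtain j where "r = 2 * j + 1" "r \<le> x" by (auto elim: oddE)
    then show "r \<in> (\<lambda>j. 2 * j + 1) ` {..<(x + 1) div 2}" by (intro image_eqI[of _ _ j]) auto
  next
    fix r assume "r \<in> (\<lambda>j. 2 * j + 1) ` {..<(x + 1) div 2}"
    then obtain j where "r = 2 * j + 1" "j < (x + 1) div 2" by blast
    then show "r \<in> {r. odd r \<and> r \<le> x}" by auto
  qed
  then show ?thesis by (simp add: card_image inj_on_def)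
qed

text \<open>Odd numbers up to \<open>N div 2 ^ k\<close> minus those up to
  \<open>N div 2 ^ Suc k\<close>. The difference is taken in the reals, away from truncated
  subtraction.\<close>

lemma card_top_odds:
  "real (card (top_odds N k)) = real ((N div 2 ^ k + 1) div 2) - real ((N div 2 ^ Suc k + 1) div 2)"
proof -
  let ?O = "\<lambda>k. {r. odd r \<and> r \<le> N div 2 ^ k}"
  have "N div 2 ^ Suc k \<le> N div 2 ^ k" by (intro div_le_mono2 power_increasing) auto
  then have sub: "?O (Suc k) \<subseteq> ?O k" by auto
  have "top_odds N k = ?O k - ?O (Suc k)"
    by (auto simp: top_odds_def less_eq_div_iff_mult_less_eq)
  then have "card (top_odds N k) = card (?O k) - card (?O (Suc k))"
    using sub by (simp add: card_Diff_subset)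
  moreover have "card (?O (Suc k)) \<le> card (?O k)"
    using sub by (intro card_mono) auto
  ultimately show ?thesis by (simp only: card_odd_le of_nat_diff)
qed

text \<open>The two integer divisions together move the count by at most \<open>1\<close> from
  \<open>N / 2 ^ (k + 1)\<close>, which is negligible after division by \<open>N\<close>.\<close>

lemma density_odd_multiples:
  "(\<lambda>N. real ((N div 2 ^ k + 1) div 2) / real N) \<longlonglongrightarrow> 1 / 2 ^ (k + 1)"
proof -
  have "\<bar>real ((N div 2 ^ k + 1) div 2) / real N - 1 / 2 ^ (k + 1)\<bar> \<le> 1 / real N" if "0 < N" for N
  proof -
    define q a b where "q = (2 ^ k :: nat)" and "a = N div q" and "b = (a + 1) div 2"
    have q: "0 < q" by (simp add: q_def)
    have "a * q \<le> N" "N < (a + 1) * q"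
      using q by (auto simp: a_def dividend_less_div_times)
    then have "real (a * q) \<le> real N" "real N \<le> real ((a + 1) * q)"
      by (simp_all only: of_nat_le_iff less_imp_le)
    then have "real a * real q \<le> real N" "real N \<le> (real a + 1) * real q"
      by (simp_all only: of_nat_mult of_nat_add of_nat_1)
    then have 1: "real a \<le> real N / real q" "real N / real q \<le> real a + 1"
      using q by (simp_all add: field_simps)
    have "a \<le> 2 * b" "2 * b \<le> a + 1" unfolding b_def by linarith+
    then have 2: "real a \<le> 2 * real b" "2 * real b \<le> real a + 1" by linarith+
    have "real N / (2 * real q) = (real N / real q) / 2" by simp
    then have "\<bar>real b - real N / (2 * real q)\<bar> \<le> 1" using 1 2 by linarith
    then have "\<bar>real b - real N / (2 * real q)\<bar> / real N \<le> 1 / real N"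
      by (intro divide_right_mono) auto
    moreover have "real b / real N - 1 / (2 * real q) = (real b - real N / (2 * real q)) / real N"
      using that by (simp add: field_simps)
    ultimately have "\<bar>real b / real N - 1 / (2 * real q)\<bar> \<le> 1 / real N"
      by (simp only: abs_divide abs_of_nat)
    then show ?thesis
      by (simp add: q_def a_def b_def)
  qed
  then have "\<forall>\<^sub>F N in sequentially. norm (real ((N div 2 ^ k + 1) div 2) / real N - 1 / 2 ^ (k + 1)) \<le> 1 / real N"
    unfolding real_norm_def using eventually_gt_at_top[of 0] by (rule eventually_mono[rotated])
  then have "(\<lambda>N. real ((N div 2 ^ k + 1) div 2) / real N - 1 / 2 ^ (k + 1)) \<longlonglongrightarrow> 0"
    by (rule Lim_null_comparison) (rule lim_1_over_n)
  then show ?thesis by (simp only: LIM_zero_iff)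
qed

lemma density_top_odds: "(\<lambda>N. real (card (top_odds N k)) / real N) \<longlonglongrightarrow> 1 / 2 ^ (k + 2)"
proof -
  have "(\<lambda>N. real (card (top_odds N k)) / real N) \<longlonglongrightarrow> 1 / 2 ^ (k + 1) - 1 / 2 ^ (Suc k + 1)"
    unfolding card_top_odds diff_divide_distrib by (intro tendsto_diff density_odd_multiples)
  then show ?thesis by (simp add: field_simps)
qed

text \<open>A crude count of all positive integers up to \<open>N / 2 ^ k\<close>, uniform in
  \<open>N\<close>, for the domination in Tannery's theorem. For \<open>N = 0\<close> the quotient
  is \<open>0\<close>.\<close>

lemma density_top_odds_le: "real (card (top_odds N k)) / real N \<le> (1 / 2) ^ k"
proof (cases "N = 0")
  case False
  have "card (top_odds N k) \<le> N div 2 ^ k"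
    using card_mono[OF _ top_odds_subset[of N k]] by simp
  then have "real (card (top_odds N k)) \<le> real (N div 2 ^ k)" by simp
  also have "\<dots> \<le> real N / 2 ^ k" by (metis of_nat_div_le_of_nat of_nat_numeral of_nat_power)
  finally show ?thesis using False by (simp add: field_simps power_one_over)
qed simp

subsection \<open>The pressure\<close>

lemma continuous_on_shift_sum:
  assumes "continuous_on Omega0 (F :: _ \<Rightarrow> real)"
  shows "continuous_on Omega0 (\<lambda>\<tau>. \<Sum>k\<in>K. F (add_shift k \<tau>))"
proof (intro continuous_on_sum continuous_on_compose2[OF assms])
  fix k
  show "continuous_on Omega0 (add_shift k)"
    unfolding add_shift_def
    by (intro continuous_on_coordinatewise_then_product continuous_on_subset[OF continuous_on_product_coordinates]) auto
  show "add_shift k ` Omega0 \<subseteq> Omega0"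
    by (auto simp: configs_def add_shift_def)
qed

text \<open>The exponent has \<open>k + 1\<close> terms of size at most \<open>B\<close>, so the
  expectation lies between \<open>exp (- (k + 1) * B)\<close> and \<open>exp ((k + 1) * B)\<close>.
  This linear growth is beaten by the densities; positivity makes the logarithms meaningful.\<close>

lemma layer_pressure_bound:
  assumes I: "is_ising_measure \<beta> J h \<mu>" and F: "continuous_on Omega0 F"
    and B: "\<And>\<tau>. \<tau> \<in> Omega0 \<Longrightarrow> \<bar>F \<tau>\<bar> \<le> B"
  shows "0 < (\<integral>\<tau>. exp (\<Sum>i=0..k. F (add_shift i \<tau>)) \<partial>\<mu>)"
    and "\<bar>layer_pressure \<mu> F k\<bar> \<le> real (Suc k) * B"
proof -
  have setsI: "sets \<mu> = sets (config_space UNIV)" using I by (rule sets_ising_measure)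
  have spI: "space \<mu> = Omega0" using sets_eq_imp_space_eq[OF setsI] by (simp add: space_config_space)
  interpret prob_space \<mu> using I by (simp add: is_ising_measure_def)
  let ?S = "\<lambda>\<tau>. \<Sum>i=0..k. F (add_shift i \<tau>)"
  have S: "- (real (Suc k) * B) \<le> ?S \<tau>" "?S \<tau> \<le> real (Suc k) * B" if "\<tau> \<in> Omega0" for \<tau>
  proof -
    have "\<bar>F (add_shift i \<tau>)\<bar> \<le> B" for i
      using that by (intro B) (auto simp: configs_def add_shift_def)
    then have "\<bar>?S \<tau>\<bar> \<le> (\<Sum>i=0..k. B)" by (intro order_trans[OF sum_abs] sum_mono)
    also have "\<dots> = real (Suc k) * B" by simp
    finally show "- (real (Suc k) * B) \<le> ?S \<tau>" "?S \<tau> \<le> real (Suc k) * B" by linarith+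
  qed
  have int: "integrable \<mu> (\<lambda>\<tau>. exp (?S \<tau>))"
  proof (rule integrable_const_bound)
    show "AE \<tau> in \<mu>. norm (exp (?S \<tau>)) \<le> exp (real (Suc k) * B)"
      using S by (intro AE_I2) (simp add: spI del: of_nat_Suc)
    show "(\<lambda>\<tau>. exp (?S \<tau>)) \<in> borel_measurable \<mu>"
      unfolding measurable_cong_sets[OF setsI refl]
      by (intro continuous_imp_measurable continuous_on_exp continuous_on_shift_sum F)
  qed
  have low: "exp (- (real (Suc k) * B)) \<le> (\<integral>\<tau>. exp (?S \<tau>) \<partial>\<mu>)"
    using int S by (intro integral_ge_const AE_I2) (simp_all add: spI del: of_nat_Suc)
  have upp: "(\<integral>\<tau>. exp (?S \<tau>) \<partial>\<mu>) \<le> exp (real (Suc k) * B)"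
    using int S by (intro integral_le_const AE_I2) (simp_all add: spI del: of_nat_Suc)
  show pos: "0 < (\<integral>\<tau>. exp (?S \<tau>) \<partial>\<mu>)"
    using low by (rule less_le_trans[OF exp_gt_zero])
  have "- (real (Suc k) * B) \<le> layer_pressure \<mu> F k"
    using low pos by (simp only: layer_pressure_def ln_ge_iff)
  moreover have "layer_pressure \<mu> F k \<le> real (Suc k) * B"
    using ln_le_cancel_iff[THEN iffD2, OF pos exp_gt_zero upp] by (simp only: layer_pressure_def ln_exp)
  ultimately show "\<bar>layer_pressure \<mu> F k\<bar> \<le> real (Suc k) * B" by linarith
qed

text \<open>The first layer of the shifted configuration is \<open>layer i \<sigma>\<close>, and for
  \<open>i = r * 2 ^ k\<close> this is the layer of \<open>r\<close> shifted by
  \<open>k\<close>.\<close>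

lemma sum_mult_shift:
  assumes "first_layer_function f fstar" "\<sigma> \<in> Omega"
  shows "(\<Sum>i=1..N. f (mult_shift i \<sigma>)) =
     (\<Sum>r | odd r \<and> r \<le> N. \<Sum>k | r * 2 ^ k \<le> N. fstar (add_shift k (layer r \<sigma>)))"
proof -
  have "f (mult_shift i \<sigma>) = fstar (layer i \<sigma>)" if "1 \<le> i" for i
  proof -
    have "\<sigma> (i * j) = -1 \<or> \<sigma> (i * j) = 1" if "1 \<le> j" for j
      using assms(2) \<open>1 \<le> i\<close> that by (intro configs_spin[where I = "{1..}"]) auto
    then have "mult_shift i \<sigma> \<in> Omega"
      unfolding configs_def mult_shift_def by (intro PiE_I) auto
    moreover have "layer 1 (mult_shift i \<sigma>) = layer i \<sigma>"
      by (auto simp: layer_def mult_shift_def)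
    ultimately show ?thesis using assms(1) by (simp add: first_layer_function_def)
  qed
  then have "(\<Sum>i=1..N. f (mult_shift i \<sigma>)) = (\<Sum>i=1..N. fstar (layer i \<sigma>))"
    by (intro sum.cong) auto
  also have "\<dots> = (\<Sum>r | odd r \<and> r \<le> N. \<Sum>k | r * 2 ^ k \<le> N. fstar (layer (r * 2 ^ k) \<sigma>))"
    by (rule sum_odd_times_power_of_2)
  finally show ?thesis
    by (simp add: layer_def add_shift_def power_add mult.assoc)
qed

text \<open>Layers in the same class contribute equal factors. The sum is written as a series, with
  zero terms for \<open>k > N\<close>, to suit Tannery's theorem; for \<open>N = 0\<close> both
  sides are \<open>0\<close>.\<close>

lemma finite_pressure_eq:
  assumes M: "is_mult_ising_measure \<beta> J h \<mu>M" and I: "is_ising_measure \<beta> J h \<mu>I"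
    and f: "first_layer_function f fstar"
  shows "finite_pressure \<mu>M f N = (\<Sum>k. real (card (top_odds N k)) / real N * layer_pressure \<mu>I fstar k)"
proof -
  have F: "continuous_on Omega0 fstar" using f by (simp add: first_layer_function_def)
  obtain B where B: "\<And>\<tau>. \<tau> \<in> Omega0 \<Longrightarrow> \<bar>fstar \<tau>\<bar> \<le> B" using bounded_on_Omega0[OF F] by metis
  have sp: "space \<mu>M = Omega"
    using sets_eq_imp_space_eq[OF sets_mult_ising_measure[OF M]] by (simp add: space_config_space)
  let ?R = "{r. odd r \<and> r \<le> N}"
  \<comment> \<open>Indexed by sets of exponents, so that \<open>ln (E K)\<close> can serve as
    \<open>g\<close> in \<open>sum_odd_le_top_odds\<close>.\<close>
  define E where "E K = (\<integral>\<tau>. exp (\<Sum>k\<in>K. fstar (add_shift k \<tau>)) \<partial>\<mu>I)" for K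
  have fin: "finite ?R" by simp
  \<comment> \<open>Needed to split the logarithm of the product.\<close>
  have E_pos: "0 < E {k. r * 2 ^ k \<le> N}" if "r \<in> ?R" for r
  proof -
    have "r \<in> (\<Union>k\<in>{..N}. top_odds N k)" using that by (simp only: odd_le_eq_UN_top_odds)
    then obtain k where "r \<in> top_odds N k" by (rule UN_E)
    then show ?thesis
      using layer_pressure_bound(1)[OF I F B] by (simp add: powers_le_top_odds E_def)
  qed
  have "(\<integral>\<sigma>. exp (\<Sum>i=1..N. f (mult_shift i \<sigma>)) \<partial>\<mu>M) =
      (\<integral>\<sigma>. (\<Prod>r\<in>?R. exp (\<Sum>k | r * 2 ^ k \<le> N. fstar (add_shift k (layer r \<sigma>)))) \<partial>\<mu>M)"
    by (intro Bochner_Integration.integral_cong refl) (simp add: sp sum_mult_shift[OF f] exp_sum del: One_nat_def)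
  also have "\<dots> = (\<Prod>r\<in>?R. E {k. r * 2 ^ k \<le> N})"
    unfolding E_def
    by (rule integral_prod_layers[OF M I fin, where F = "\<lambda>r \<tau>. exp (\<Sum>k | r * 2 ^ k \<le> N. fstar (add_shift k \<tau>))"])
       (auto intro!: continuous_on_exp continuous_on_shift_sum F)
  also have "ln \<dots> = (\<Sum>r\<in>?R. ln (E {k. r * 2 ^ k \<le> N}))"
    by (intro ln_prod fin) (metis E_pos less_irrefl)
  also have "\<dots> = (\<Sum>k\<le>N. real (card (top_odds N k)) * ln (E {0..k}))"
    by (rule sum_odd_le_top_odds)
  finally have "finite_pressure \<mu>M f N = (\<Sum>k\<le>N. real (card (top_odds N k)) / real N * layer_pressure \<mu>I fstar k)"
    by (simp add: finite_pressure_def layer_pressure_def E_def sum_divide_distrib del: One_nat_def)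
  also have "\<dots> = (\<Sum>k. real (card (top_odds N k)) / real N * layer_pressure \<mu>I fstar k)"
    by (rule suminf_finite[symmetric]) (auto simp: top_odds_empty)
  finally show ?thesis .
qed

theorem mainTheorem7:
  fixes \<beta> J h :: real
    and \<mu>M \<mu>I :: "(nat \<Rightarrow> real) measure"
    and f fstar :: "(nat \<Rightarrow> real) \<Rightarrow> real"
  assumes "\<beta> > 0"
    and "is_mult_ising_measure \<beta> J h \<mu>M"
    and "is_ising_measure \<beta> J h \<mu>I"
    and "first_layer_function f fstar"
  shows "summable (\<lambda>k. 1 / 2 ^ (k + 2) * layer_pressure \<mu>I fstar k) \<and>
    finite_pressure \<mu>M f \<longlonglongrightarrow> (\<Sum>k. 1 / 2 ^ (k + 2) * layer_pressure \<mu>I fstar k)"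
proof -
  have F: "continuous_on Omega0 fstar" using assms(4) by (simp add: first_layer_function_def)
  obtain B where B: "0 \<le> B" "\<And>\<tau>. \<tau> \<in> Omega0 \<Longrightarrow> \<bar>fstar \<tau>\<bar> \<le> B"
    using bounded_on_Omega0[OF F] by metis
  let ?a = "\<lambda>k N. real (card (top_odds N k)) / real N * layer_pressure \<mu>I fstar k"
  \<comment> \<open>The majorant multiplies the density bound by the pressure bound; it is summable
    as a differentiated geometric series.\<close>
  let ?M = "\<lambda>k. real (Suc k) * (1 / 2) ^ k * B"
  have "summable (\<lambda>k. real (Suc k) * (1 / 2) ^ k)"
    by (rule sums_summable[OF geometric_deriv_sums]) simp
  then have sM: "summable ?M" by (rule summable_mult2)
  have bound: "norm (?a k N) \<le> ?M k" for k N
  proof -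
    have "norm (?a k N) \<le> (1 / 2) ^ k * (real (Suc k) * B)"
      unfolding real_norm_def abs_mult
      using density_top_odds_le[of N k] layer_pressure_bound(2)[OF assms(3) F B(2)]
      by (intro mult_mono) (auto simp del: of_nat_Suc)
    then show ?thesis by (simp only: mult_ac)
  qed
  have lim: "(\<lambda>N. ?a k N) \<longlonglongrightarrow> 1 / 2 ^ (k + 2) * layer_pressure \<mu>I fstar k" for k
    by (intro tendsto_mult_right density_top_odds)
  \<comment> \<open>Tannery's theorem exchanges the limit in \<open>N\<close> with the series and
    also gives absolute convergence of the limit series.\<close>
  have "summable (\<lambda>k. norm (1 / 2 ^ (k + 2) * layer_pressure \<mu>I fstar k)) \<and>
      (\<lambda>N. \<Sum>k. ?a k N) \<longlonglongrightarrow> (\<Sum>k. 1 / 2 ^ (k + 2) * layer_pressure \<mu>I fstar k)"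
    by (rule tannerys_theorem[OF lim always_eventually sM sequentially_bot, THEN conjunct2])
      (use bound in blast)
  then show ?thesis
    unfolding finite_pressure_eq[OF assms(2,3,4), abs_def]
    by (blast intro: summable_norm_cancel)
qed

end
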